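(* Let $(\mathcal X,\mathsf d)$ be a metric local structure. Then $(\Upsilon,\tau_{\mathrm v},\mathsf d_\Upsilon)$ is an extended metric-topological space.
   Context: A metric local structure $(\mathcal X,\mathsf d)$, $\mathcal X=(X,\tau,\Sigma,\mathsf m,\mathscr E_{\mathsf d})$, consists of a non-empty complete separable metric space $(X,\mathsf d)$ with topology $\tau$, a $\sigma$-algebra $\Sigma$ with $\mathscr B_\tau\subset\Sigma\subset\mathscr B_\tau^{\mathsf m}$ (Borel $\sigma$-algebra and its $\mathsf m$-completion), and a $\sigma$-finite atomless Radon measure $\mathsf m$ on $\Sigma$ with full support, finite on every set of the ring $\mathscr E_{\mathsf d}$ of all $\mathsf d$-bounded sets in $\Sigma$. $\Upsilon$ is the set of all $\gamma=\sum_{i\le N}\delta_{x_i}$, $N\in\mathbb N_0\cup\{\infty\}$, $x_i\in X$ (repetitions allowed), with $\gamma E<\infty$ for all $E\in\mathscr E_{\mathsf d}$; $\tau_{\mathrm v}$ is the topology on $\Upsilon$ generated by $\gamma\mapsto\int f\,d\gamma$, $f$ bounded continuous vanishing outside a bounded set. $\mathsf d_\Upsilon(\gamma,\eta)=\inf_q\big(\int_{X\times X}\mathsf d^2(x,y)\,dq(x,y)\big)^{1/2}\in[0,\infty]$, the infimum over measures $q$ on $X\times X$ with marginals $\gamma,\eta$ ($\inf\emptyset=+\infty$). A uniformity (of pseudo-distances) on a Hausdorff topological space $Y$ is a family $\mathsf{UP}$ of pseudo-distances which is directed ($\mathsf d_1\vee\mathsf d_2\in\mathsf{UP}$ for $\mathsf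 d_1,\mathsf d_2\in\mathsf{UP}$) and order-closed ($\mathsf d_1\le\mathsf d_2\in\mathsf{UP}$ implies $\mathsf d_1\in\mathsf{UP}$ for every pseudo-distance $\mathsf d_1$); it is Hausdorff if it separates points. For an extended distance $\mathsf d':Y\times Y\to[0,\infty]$ on a topological space $(Y,\tau')$, the triple $(Y,\tau',\mathsf d')$ is an extended metric-topological space if there is a Hausdorff uniformity $\mathsf{UP}$ of $\tau'$-continuous pseudo-distances $Y\times Y\to[0,\infty)$ generating $\tau'$ and such that $\mathsf d'=\sup\{\rho:\rho\in\mathsf{UP}\}$. *)

theory Defs
  imports "HOL-Probability.Probability"
begin

definition radon :: "'a::topological_space measure \<Rightarrow> bool" where
  "radon M \<longleftrightarrow>
     (\<forall>x. \<exists>U. open U \<and> x \<in> U \<and> emeasure M U < \<infinity>) \<and>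
     (\<forall>A\<in>sets M. emeasure M A = (SUP K\<in>{K. compact K \<and> K \<subseteq> A}. emeasure M K))"

definition atomless :: "'a measure \<Rightarrow> bool" where
  "atomless M \<longleftrightarrow>
     (\<forall>A\<in>sets M. 0 < emeasure M A \<longrightarrow>
        (\<exists>B\<in>sets M. B \<subseteq> A \<and> 0 < emeasure M B \<and> emeasure M B < emeasure M A))"

definition full_support :: "'a::topological_space measure \<Rightarrow> bool" where
  "full_support M \<longleftrightarrow> (\<forall>U. open U \<and> U \<noteq> {} \<longrightarrow> 0 < emeasure M U)"

text \<open>The complete separable metric space is the universe of the type, with metric \<open>dist\<close>;
  the measure \<open>M\<close> carries the \<open>\<sigma>\<close>-algebra \<open>sets M\<close>.\<close>

definition bounded_ring :: "'a::metric_space measure \<Rightarrow> 'a set set" where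
  "bounded_ring M = {E \<in> sets M. bounded E}"

locale metric_local_structure = sigma_finite_measure M
  for M :: "'a::polish_space measure" +
  assumes borel_subalgebra: "subalgebra M borel"
    and sets_le_completion: "sets M \<subseteq> sets (completion (restr_to_subalg M borel))"
    and radon: "radon M"
    and atomless: "atomless M"
    and full_support: "full_support M"
    and finite_on_bounded: "E \<in> bounded_ring M \<Longrightarrow> emeasure M E < \<infinity>"

text \<open>Only the first \<open>N\<close> terms of the sequence \<open>x\<close> are relevant; repetitions are allowed.
  Of \<open>M\<close>, only the \<open>\<sigma>\<close>-algebra is used here and below.\<close>

definition configurations :: "'a::metric_space measure \<Rightarrow> 'a measure set" where
  "configurations M = {\<gamma>. sets \<gamma> = sets M \<and>
     (\<exists>(N::enat) (x::nat \<Rightarrow> 'a). \<forall>A\<in>sets M.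
        emeasure \<gamma> A = (\<Sum>i. if enat i < N then emeasure (return M (x i)) A else 0)) \<and>
     (\<forall>E\<in>bounded_ring M. emeasure \<gamma> E < \<infinity>)}"

definition vague_test_functions :: "('a::metric_space \<Rightarrow> real) set" where
  "vague_test_functions = {f. continuous_on UNIV f \<and> bounded (range f) \<and>
     (\<exists>B. bounded B \<and> (\<forall>x. x \<notin> B \<longrightarrow> f x = 0))}"

definition vague_topology :: "'a::metric_space measure \<Rightarrow> 'a measure topology" where
  "vague_topology M = topology_generated_by
     {{\<gamma> \<in> configurations M. integral\<^sup>L \<gamma> f \<in> U} | f U. f \<in> vague_test_functions \<and> open U}"

definition couplings :: "'a measure \<Rightarrow> 'a measure \<Rightarrow> 'a measure \<Rightarrow> ('a \<times> 'a) measure set" where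
  "couplings M \<gamma> \<eta> = {q. sets q = sets (M \<Otimes>\<^sub>M M) \<and> distr q M fst = \<gamma> \<and> distr q M snd = \<eta>}"

definition ennreal_sqrt :: "ennreal \<Rightarrow> ennreal" where
  "ennreal_sqrt c = (if c = \<infinity> then \<infinity> else ennreal (sqrt (enn2real c)))"

definition transport_dist :: "'a::metric_space measure \<Rightarrow> 'a measure \<Rightarrow> 'a measure \<Rightarrow> ennreal" where
  "transport_dist M \<gamma> \<eta> =
     (INF q\<in>couplings M \<gamma> \<eta>. ennreal_sqrt (\<integral>\<^sup>+ (x, y). ennreal ((dist x y)\<^sup>2) \<partial>q))"

text \<open>All conditions constrain functions of two arguments only on the carrier \<open>Y\<close>; values
  outside the carrier are irrelevant.\<close>

definition pseudo_distance_on :: "'y set \<Rightarrow> ('y \<Rightarrow> 'y \<Rightarrow> real) \<Rightarrow> bool" where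
  "pseudo_distance_on Y \<rho> \<longleftrightarrow>
     (\<forall>x\<in>Y. \<forall>y\<in>Y. 0 \<le> \<rho> x y \<and> \<rho> x y = \<rho> y x) \<and>
     (\<forall>x\<in>Y. \<rho> x x = 0) \<and>
     (\<forall>x\<in>Y. \<forall>y\<in>Y. \<forall>z\<in>Y. \<rho> x z \<le> \<rho> x y + \<rho> y z)"

definition extended_distance_on :: "'y set \<Rightarrow> ('y \<Rightarrow> 'y \<Rightarrow> ennreal) \<Rightarrow> bool" where
  "extended_distance_on Y d \<longleftrightarrow>
     (\<forall>x\<in>Y. \<forall>y\<in>Y. d x y = d y x \<and> (d x y = 0 \<longleftrightarrow> x = y)) \<and>
     (\<forall>x\<in>Y. \<forall>y\<in>Y. \<forall>z\<in>Y. d x z \<le> d x y + d y z)"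

definition uniformity_on :: "'y set \<Rightarrow> ('y \<Rightarrow> 'y \<Rightarrow> real) set \<Rightarrow> bool" where
  "uniformity_on Y UP \<longleftrightarrow>
     (\<forall>\<rho>\<in>UP. pseudo_distance_on Y \<rho>) \<and>
     (\<forall>\<rho>1\<in>UP. \<forall>\<rho>2\<in>UP. (\<lambda>x y. max (\<rho>1 x y) (\<rho>2 x y)) \<in> UP) \<and>
     (\<forall>\<rho>1. \<forall>\<rho>2\<in>UP. pseudo_distance_on Y \<rho>1 \<and> (\<forall>x\<in>Y. \<forall>y\<in>Y. \<rho>1 x y \<le> \<rho>2 x y) \<longrightarrow> \<rho>1 \<in> UP)"

definition separates_points_on :: "'y set \<Rightarrow> ('y \<Rightarrow> 'y \<Rightarrow> real) set \<Rightarrow> bool" where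
  "separates_points_on Y UP \<longleftrightarrow> (\<forall>x\<in>Y. \<forall>y\<in>Y. x \<noteq> y \<longrightarrow> (\<exists>\<rho>\<in>UP. \<rho> x y \<noteq> 0))"

definition uniformity_topology :: "'y set \<Rightarrow> ('y \<Rightarrow> 'y \<Rightarrow> real) set \<Rightarrow> 'y topology" where
  "uniformity_topology Y UP = topology_generated_by
     {{y \<in> Y. \<rho> x y < r} | \<rho> x r. \<rho> \<in> UP \<and> x \<in> Y \<and> 0 < r}"

definition extended_metric_topological_space ::
    "'y set \<Rightarrow> 'y topology \<Rightarrow> ('y \<Rightarrow> 'y \<Rightarrow> ennreal) \<Rightarrow> bool" where
  "extended_metric_topological_space Y T d \<longleftrightarrow>
     topspace T = Y \<and> Hausdorff_space T \<and> extended_distance_on Y d \<and>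
     (\<exists>UP. uniformity_on Y UP \<and> separates_points_on Y UP \<and>
        (\<forall>\<rho>\<in>UP. continuous_map (prod_topology T T) euclideanreal (\<lambda>(x, y). \<rho> x y)) \<and>
        uniformity_topology Y UP = T \<and>
        (\<forall>x\<in>Y. \<forall>y\<in>Y. d x y = (SUP \<rho>\<in>UP. ennreal (\<rho> x y))))"

end

theory Submission
  imports Defs "HOL-Complex_Analysis.Great_Picard"
begin

text \<open>
  The distance \<open>d\<^sub>\<Upsilon>\<close> is the supremum of countably many finite, vaguely continuous pseudo-distances that
  generate the vague topology. The \<open>n\<close>-th one, \<open>level_dist n\<close>, is an optimal transport pseudo-distance
  in which mass may also be exchanged with a reservoir, at the cost \<open>(h x)\<^sup>2\<close> per unit of mass at \<open>x\<close>,
  where \<open>h x\<close> is the positive part of \<open>n\<close> minus the distance of \<open>x\<close> from a fixed centre. A configuration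
  has finitely many points where \<open>h\<close> is positive, hence this cost is finite, while outside the ball of
  radius \<open>n\<close> all mass can be created and destroyed for free. Configurations are treated as families of
  point masses, and transport plans as matrices of non-negative weights, so that sums over the pairs of
  points replace integrals.

  Five facts carry the proof. The triangle inequality follows by gluing plans (\<open>plan_glue\<close>). A vaguely
  small change of a configuration is small for \<open>level_dist n\<close>, because the nearby masses can be matched
  by means of tent functions around the finitely many points (\<open>plan_to_nearby\<close>,
  \<open>small_balls_level_dist\<close>). Conversely, if \<open>level_dist n\<close> is small for a large \<open>n\<close>, the integrals of
  a given test function are close (\<open>integral_close_of_plan\<close>, \<open>vague_neighbourhood_level_dist\<close>). Every
  coupling of two configurations is a plan without use of the reservoir, hence
  \<open>level_dist n \<le> d\<^sub>\<Upsilon>\<close> (\<open>plan_of_coupling\<close>). Finally, if the costs stay bounded as \<open>n\<close> tends to infinity,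
  the plans converge along a subsequence to a genuine coupling, because mass cannot be moved far and
  each bounded set contains finitely many points (\<open>plan_limit\<close>); Fatou's lemma then shows that \<open>d\<^sub>\<Upsilon>\<close> is
  the supremum of the level distances (\<open>transport_dist_eq_SUP\<close>).

  A countable family of pseudo-distances with these properties suffices
  (\<open>extended_metric_topological_spaceI\<close>): the continuous pseudo-distances below the supremum form the
  required uniformity, and the axioms of an extended distance are inherited by the supremum.
\<close>

section \<open>Unordered sums of extended non-negative numbers\<close>

text \<open>The sum of all values of a function, over an arbitrary, possibly uncountable, index type.\<close>

abbreviation usum :: "('b \<Rightarrow> ennreal) \<Rightarrow> ennreal" (binder "\<Sum>\<^sup>+" 10)
  where "usum f \<equiv> integral\<^sup>N (count_space UNIV) f"

lemma usum_swap: "(\<Sum>\<^sup>+x. \<Sum>\<^sup>+y. f x y) = (\<Sum>\<^sup>+y. \<Sum>\<^sup>+x. f x y)"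
  using nn_integral_fst_count_space[of "\<lambda>(x, y). f x y"]
    nn_integral_snd_count_space[of "\<lambda>(x, y). f x y"] by simp

lemma usum_pair: "(\<Sum>\<^sup>+x. \<Sum>\<^sup>+y. f x y) = (\<Sum>\<^sup>+p. f (fst p) (snd p))"
  using nn_integral_fst_count_space[of "\<lambda>p. f (fst p) (snd p)"] by simp

lemma usum_option: "(\<Sum>\<^sup>+z. f z) = f None + (\<Sum>\<^sup>+x. f (Some x))"
proof -
  have "(\<Sum>\<^sup>+z. f z) = (\<Sum>\<^sup>+z. f z * indicator {None} z + f z * indicator (range Some) z)"
    by (intro nn_integral_cong) (auto split: split_indicator simp: notin_range_Some)
  also have "\<dots> = f None + (\<Sum>\<^sup>+z. f z * indicator (range Some) z)"
    by (subst nn_integral_add) (auto simp: nn_integral_count_space_indicator[symmetric] nn_integral_count_space_finite)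
  also have "(\<Sum>\<^sup>+z. f z * indicator (range Some) z) = (\<integral>\<^sup>+z. f z \<partial>count_space (range Some))"
    by (simp add: nn_integral_count_space_indicator)
  also have "\<dots> = (\<Sum>\<^sup>+x. f (Some x))"
    by (rule nn_integral_bij_count_space[symmetric]) (simp add: bij_betw_def)
  finally show ?thesis .
qed

lemma usum_ge_point: "f x \<le> (\<Sum>\<^sup>+x. f x)"
  using nn_integral_ge_point[of x UNIV f] by simp

lemma usum_finite_support:
  assumes "finite F" and "\<And>x. x \<notin> F \<Longrightarrow> f x = 0"
  shows "(\<Sum>\<^sup>+x. f x) = sum f F"
  using nn_integral_count_space'[of F UNIV f] assms by auto

lemma usum_single: "(\<And>y. y \<noteq> x \<Longrightarrow> f y = 0) \<Longrightarrow> (\<Sum>\<^sup>+y. f y) = f x"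
  using usum_finite_support[of "{x}" f] by auto

lemma usum_sum: "(\<Sum>\<^sup>+x. \<Sum>i\<in>I. f i x) = (\<Sum>i\<in>I. \<Sum>\<^sup>+x. f i x)"
  by (rule nn_integral_sum) auto

lemma usum_add: "(\<Sum>\<^sup>+x. f x + g x) = (\<Sum>\<^sup>+x. f x) + (\<Sum>\<^sup>+x. g x)"
  by (rule nn_integral_add) auto

lemma usum_cmult: "(\<Sum>\<^sup>+x. c * f x) = c * (\<Sum>\<^sup>+x. f x)"
  by (rule nn_integral_cmult) auto

lemma usum_multc: "(\<Sum>\<^sup>+x. f x * c) = (\<Sum>\<^sup>+x. f x) * c"
  by (rule nn_integral_multc) auto

lemma usum_mono: "(\<And>x. f x \<le> g x) \<Longrightarrow> (\<Sum>\<^sup>+x. f x) \<le> (\<Sum>\<^sup>+x. g x)"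
  by (rule nn_integral_mono) auto

section \<open>Transport plans with a reservoir\<close>

text \<open>A cut-off is the height of the points of the space above a reservoir: non-negative, 1-Lipschitz and
  zero outside a bounded set. Mass may be created or destroyed at \<open>x\<close> by moving it to or from the
  reservoir, at distance \<open>h x\<close>.\<close>

definition cutoff :: "('a::metric_space \<Rightarrow> real) \<Rightarrow> bool" where
  "cutoff h \<longleftrightarrow> (\<forall>x. 0 \<le> h x) \<and> (\<forall>x y. h x \<le> h y + dist x y) \<and>
     bounded {x. h x \<noteq> 0}"

text \<open>The pseudo-distance on the space with the reservoir added as the point \<open>None\<close>: it is the shortest-path
  pseudo-distance when one may travel directly or through the reservoir.\<close>

definition res_dist :: "('a::metric_space \<Rightarrow> real) \<Rightarrow> 'a option \<Rightarrow> 'a option \<Rightarrow> real" where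
  "res_dist h a b =
     (case a of
        None \<Rightarrow> (case b of None \<Rightarrow> 0 | Some y \<Rightarrow> h y)
      | Some x \<Rightarrow> (case b of None \<Rightarrow> h x | Some y \<Rightarrow> min (dist x y) (h x + h y)))"

lemma res_dist_simps [simp]:
  "res_dist h None None = 0"
  "res_dist h None (Some y) = h y"
  "res_dist h (Some x) None = h x"
  "res_dist h (Some x) (Some y) = min (dist x y) (h x + h y)"
  by (simp_all add: res_dist_def)

lemma cutoff_nonneg: "cutoff h \<Longrightarrow> 0 \<le> h x"
  by (simp add: cutoff_def)

lemma cutoff_lipschitz: "cutoff h \<Longrightarrow> h x \<le> h y + dist x y"
  by (simp add: cutoff_def)

lemma res_dist_nonneg: "cutoff h \<Longrightarrow> 0 \<le> res_dist h a b"
  by (cases a; cases b) (auto simp: cutoff_nonneg)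

lemma res_dist_commute: "res_dist h a b = res_dist h b a"
  by (cases a; cases b) (auto simp: dist_commute)

lemma res_dist_triangle:
  assumes "cutoff h"
  shows "res_dist h a c \<le> res_dist h a b + res_dist h b c"
proof (cases a; cases b; cases c)
  fix x y z assume "a = Some x" "b = Some y" "c = Some z"
  then show ?thesis
    using cutoff_lipschitz[OF assms, of x y] cutoff_lipschitz[OF assms, of z y]
      cutoff_nonneg[OF assms, of x] cutoff_nonneg[OF assms, of y] cutoff_nonneg[OF assms, of z]
      dist_triangle[of x z y] by (simp add: dist_commute)
next
  fix x y assume "a = Some x" "b = Some y" "c = None"
  then show ?thesis
    using cutoff_lipschitz[OF assms, of x y] cutoff_nonneg[OF assms, of y] by simp
next
  fix y z assume "a = None" "b = Some y" "c = Some z"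
  then show ?thesis
    using cutoff_lipschitz[OF assms, of z y] cutoff_nonneg[OF assms, of y]
    by (simp add: dist_commute)
qed (auto simp: cutoff_nonneg assms)

text \<open>A plan between two families of point masses prescribes the marginals at the points of the space and
  leaves the reservoir unconstrained. Plans between infinite families are allowed.\<close>

definition plan :: "('a \<Rightarrow> ennreal) \<Rightarrow> ('a \<Rightarrow> ennreal) \<Rightarrow> ('a option \<Rightarrow> 'a option \<Rightarrow> ennreal) \<Rightarrow> bool" where
  "plan m1 m2 w \<longleftrightarrow>
     (\<forall>x. (\<Sum>\<^sup>+b. w (Some x) b) = m1 x) \<and> (\<forall>y. (\<Sum>\<^sup>+a. w a (Some y)) = m2 y)"

text \<open>The quadratic cost of a plan for the pseudo-distance with reservoir.\<close>

definition cost :: "('a::metric_space \<Rightarrow> real) \<Rightarrow> ('a option \<Rightarrow> 'a option \<Rightarrow> ennreal) \<Rightarrow> ennreal" where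
  "cost h w = (\<Sum>\<^sup>+a. \<Sum>\<^sup>+b. w a b * ennreal ((res_dist h a b)\<^sup>2))"

lemma plan_transpose: "plan m1 m2 w \<Longrightarrow> plan m2 m1 (\<lambda>a b. w b a)"
  by (simp add: plan_def)

lemma cost_transpose: "cost h (\<lambda>a b. w b a) = cost h w"
  unfolding cost_def by (subst usum_swap) (simp add: res_dist_commute)

lemma plan_le_left: "plan m1 m2 w \<Longrightarrow> w (Some x) b \<le> m1 x"
  using usum_ge_point[of "w (Some x)" b] by (simp add: plan_def)

lemma plan_le_right: "plan m1 m2 w \<Longrightarrow> w a (Some y) \<le> m2 y"
  using usum_ge_point[of "\<lambda>a. w a (Some y)" a] by (simp add: plan_def)

text \<open>Gluing two plans along the intermediate masses gives the triangle inequality. Mass sent to the reservoir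
  in the first step stays there in the second one; mass that leaves it in the second step has stayed
  there in the first one.\<close>

lemma plan_glue:
  fixes m2 :: "'a::metric_space \<Rightarrow> ennreal"
  assumes h: "cutoff h" and fin: "\<And>y. m2 y < \<top>"
    and u: "plan m1 m2 u" and v: "plan m2 m3 v"
    and a: "0 < a" "cost h u \<le> ennreal (a\<^sup>2)" and b: "0 < b" "cost h v \<le> ennreal (b\<^sup>2)"
  shows "\<exists>w. plan m1 m3 w \<and> cost h w \<le> ennreal ((a + b)\<^sup>2)"
proof -
  \<comment> \<open>The mass moved along the path from \<open>p\<close> through \<open>q\<close> to \<open>r\<close>. Where \<open>m2 y = 0\<close>, both \<open>u\<close> and
    \<open>v\<close> vanish and the quotient is zero. Its marginals can differ from \<open>u\<close> and \<open>v\<close> only at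
    \<open>(None, None)\<close>, where the cost is zero.\<close>
  define g where "g = (\<lambda>p q r. case q of
      Some y \<Rightarrow> u p (Some y) * v (Some y) r / m2 y
    | None \<Rightarrow> (if r = None then u p None else 0) + (if p = None then v None r else 0))"
  have g1: "(\<Sum>\<^sup>+r. g p q r) = u p q" if pq: "(p, q) \<noteq> (None, None)" for p q
  proof (cases q)
    case None
    then obtain x where p: "p = Some x" using pq None by (cases p) auto
    have "(\<Sum>\<^sup>+r. g p q r) = (\<Sum>\<^sup>+r::'a option. if r = None then u p None else 0)"
      unfolding g_def None p by simp
    also have "\<dots> = u p None"
      by (subst usum_single[where x = None]) auto
    finally show ?thesis by (simp add: None)
  next
    case (Some y)
    have "(\<Sum>\<^sup>+r. g p q r) = u p (Some y) * (\<Sum>\<^sup>+r. v (Some y) r) / m2 y"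
      by (simp add: g_def Some divide_ennreal_def usum_multc usum_cmult)
    also have "\<dots> = u p (Some y) * (m2 y / m2 y)"
      using v by (simp add: plan_def ennreal_times_divide)
    also have "\<dots> = u p (Some y)"
      using plan_le_right[OF u, of p y] fin[of y]
      by (cases "m2 y = 0") (auto simp: ennreal_divide_self)
    finally show ?thesis by (simp add: Some)
  qed
  have g3: "(\<Sum>\<^sup>+p. g p q r) = v q r" if qr: "(q, r) \<noteq> (None, None)" for q r
  proof (cases q)
    case None
    then obtain z where r: "r = Some z" using qr None by (cases r) auto
    have "(\<Sum>\<^sup>+p. g p q r) = (\<Sum>\<^sup>+p::'a option. if p = None then v None r else 0)"
      unfolding g_def None r by simp
    also have "\<dots> = v None r"
      by (subst usum_single[where x = None]) auto
    finally show ?thesis by (simp add: None)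
  next
    case (Some y)
    have "(\<Sum>\<^sup>+p. g p q r) = (\<Sum>\<^sup>+p. u p (Some y)) * v (Some y) r / m2 y"
      by (simp add: g_def Some divide_ennreal_def usum_multc)
    also have "\<dots> = v (Some y) r * (m2 y / m2 y)"
      using u by (simp add: plan_def ennreal_times_divide mult.commute)
    also have "\<dots> = v (Some y) r"
      using plan_le_left[OF v, of y r] fin[of y]
      by (cases "m2 y = 0") (auto simp: ennreal_divide_self)
    finally show ?thesis by (simp add: Some)
  qed
  define w where "w = (\<lambda>p r. \<Sum>\<^sup>+q. g p q r)"
  have "plan m1 m3 w"
    unfolding plan_def
  proof (intro conjI allI)
    fix x
    have "(\<Sum>\<^sup>+r. w (Some x) r) = (\<Sum>\<^sup>+q. \<Sum>\<^sup>+r. g (Some x) q r)"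
      unfolding w_def by (rule usum_swap)
    also have "\<dots> = m1 x"
      using u by (simp add: g1 plan_def)
    finally show "(\<Sum>\<^sup>+r. w (Some x) r) = m1 x" .
  next
    fix z
    have "(\<Sum>\<^sup>+p. w p (Some z)) = (\<Sum>\<^sup>+q. \<Sum>\<^sup>+p. g p q (Some z))"
      unfolding w_def by (rule usum_swap)
    also have "\<dots> = m3 z"
      using v by (simp add: g3 plan_def)
    finally show "(\<Sum>\<^sup>+p. w p (Some z)) = m3 z" .
  qed
  moreover have "cost h w \<le> ennreal ((a + b)\<^sup>2)"
  proof -
    let ?d = "res_dist h"
    define s where "s = 1 + b / a"
    define t where "t = 1 + a / b"
    have st: "0 \<le> s" "0 \<le> t" using a b by (auto simp: s_def t_def)
    \<comment> \<open>Minkowski's inequality, in the form of Young's inequality with the optimal parameter.\<close>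
    have young: "(?d p r)\<^sup>2 \<le> s * (?d p q)\<^sup>2 + t * (?d q r)\<^sup>2" for p q r
    proof -
      have "(?d p r)\<^sup>2 \<le> (?d p q + ?d q r)\<^sup>2"
        by (intro power_mono res_dist_triangle res_dist_nonneg h)
      also have "\<dots> \<le> s * (?d p q)\<^sup>2 + t * (?d q r)\<^sup>2"
      proof -
        have "0 \<le> (b * ?d p q - a * ?d q r)\<^sup>2 / (a * b)" using a b by simp
        also have "\<dots> = s * (?d p q)\<^sup>2 + t * (?d q r)\<^sup>2 - (?d p q + ?d q r)\<^sup>2"
          using a b by (simp add: s_def t_def field_simps power2_eq_square)
        finally show ?thesis by simp
      qed
      finally show ?thesis .
    qed
    have "cost h w = (\<Sum>\<^sup>+p. \<Sum>\<^sup>+r. \<Sum>\<^sup>+q. g p q r * ennreal ((?d p r)\<^sup>2))"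
      by (simp add: cost_def w_def usum_multc)
    also have "\<dots> \<le> (\<Sum>\<^sup>+p. \<Sum>\<^sup>+r. \<Sum>\<^sup>+q. g p q r * (ennreal s * ennreal ((?d p q)\<^sup>2) + ennreal t * ennreal ((?d q r)\<^sup>2)))"
      using young st by (intro usum_mono mult_left_mono)
        (auto simp: ennreal_mult[symmetric] ennreal_plus[symmetric] simp del: ennreal_plus)
    also have "\<dots> = ennreal s * (\<Sum>\<^sup>+p. \<Sum>\<^sup>+r. \<Sum>\<^sup>+q. g p q r * ennreal ((?d p q)\<^sup>2))
        + ennreal t * (\<Sum>\<^sup>+p. \<Sum>\<^sup>+r. \<Sum>\<^sup>+q. g p q r * ennreal ((?d q r)\<^sup>2))"
      by (simp add: distrib_left usum_add usum_cmult mult.left_commute)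
    also have "(\<Sum>\<^sup>+p. \<Sum>\<^sup>+r. \<Sum>\<^sup>+q. g p q r * ennreal ((?d p q)\<^sup>2)) = cost h u"
    proof -
      have *: "(\<Sum>\<^sup>+r. g p q r) * ennreal ((?d p q)\<^sup>2) = u p q * ennreal ((?d p q)\<^sup>2)" for p q
        using g1[of p q] by (cases "(p, q) = (None, None)") auto
      have "(\<Sum>\<^sup>+p. \<Sum>\<^sup>+r. \<Sum>\<^sup>+q. g p q r * ennreal ((?d p q)\<^sup>2))
          = (\<Sum>\<^sup>+p. \<Sum>\<^sup>+q. \<Sum>\<^sup>+r. g p q r * ennreal ((?d p q)\<^sup>2))"
        by (subst usum_swap) (rule refl)
      also have "\<dots> = cost h u"
        by (simp add: usum_multc * cost_def)
      finally show ?thesis .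
    qed
    also have "(\<Sum>\<^sup>+p. \<Sum>\<^sup>+r. \<Sum>\<^sup>+q. g p q r * ennreal ((?d q r)\<^sup>2)) = cost h v"
    proof -
      have *: "(\<Sum>\<^sup>+p. g p q r) * ennreal ((?d q r)\<^sup>2) = v q r * ennreal ((?d q r)\<^sup>2)" for q r
        using g3[of q r] by (cases "(q, r) = (None, None)") auto
      have "(\<Sum>\<^sup>+p. \<Sum>\<^sup>+r. \<Sum>\<^sup>+q. g p q r * ennreal ((?d q r)\<^sup>2))
          = (\<Sum>\<^sup>+r. \<Sum>\<^sup>+q. \<Sum>\<^sup>+p. g p q r * ennreal ((?d q r)\<^sup>2))"
        by (subst usum_swap, subst (2) usum_swap) (rule refl)
      also have "\<dots> = (\<Sum>\<^sup>+q. \<Sum>\<^sup>+r. \<Sum>\<^sup>+p. g p q r * ennreal ((?d q r)\<^sup>2))"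
        by (rule usum_swap)
      also have "\<dots> = cost h v"
        by (simp add: usum_multc * cost_def)
      finally show ?thesis .
    qed
    also have "ennreal s * cost h u + ennreal t * cost h v \<le> ennreal s * ennreal (a\<^sup>2) + ennreal t * ennreal (b\<^sup>2)"
      by (intro add_mono mult_left_mono a b) auto
    also have "\<dots> = ennreal (s * a\<^sup>2 + t * b\<^sup>2)"
      using st by (simp add: ennreal_mult)
    also have "s * a\<^sup>2 + t * b\<^sup>2 = (a + b)\<^sup>2"
      using a b by (simp add: s_def t_def field_simps power2_eq_square)
    finally show ?thesis .
  qed
  ultimately show ?thesis by blast
qed

text \<open>Completing a sub-coupling: all mass that it does not move goes to or comes from the reservoir.\<close>

lemma plan_of_partial:
  fixes m1 m2 :: "'a::metric_space \<Rightarrow> ennreal"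
  assumes row: "\<And>x. (\<Sum>\<^sup>+y. p x y) \<le> m1 x" and col: "\<And>y. (\<Sum>\<^sup>+x. p x y) \<le> m2 y"
    and h: "cutoff h"
  shows "\<exists>w. plan m1 m2 w \<and> cost h w \<le> (\<Sum>\<^sup>+x. \<Sum>\<^sup>+y. p x y * ennreal ((dist x y)\<^sup>2))
      + (\<Sum>\<^sup>+x. (m1 x - (\<Sum>\<^sup>+y. p x y)) * ennreal ((h x)\<^sup>2))
      + (\<Sum>\<^sup>+y. (m2 y - (\<Sum>\<^sup>+x. p x y)) * ennreal ((h y)\<^sup>2))"
proof -
  define w where "w = (\<lambda>a b. case a of
      Some x \<Rightarrow> (case b of Some y \<Rightarrow> p x y | None \<Rightarrow> m1 x - (\<Sum>\<^sup>+y. p x y))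
    | None \<Rightarrow> (case b of Some y \<Rightarrow> m2 y - (\<Sum>\<^sup>+x. p x y) | None \<Rightarrow> 0))"
  have "plan m1 m2 w"
    using row col by (simp add: plan_def usum_option w_def diff_add_cancel_ennreal)
  moreover have "cost h w \<le> (\<Sum>\<^sup>+x. \<Sum>\<^sup>+y. p x y * ennreal ((dist x y)\<^sup>2))
      + (\<Sum>\<^sup>+x. (m1 x - (\<Sum>\<^sup>+y. p x y)) * ennreal ((h x)\<^sup>2))
      + (\<Sum>\<^sup>+y. (m2 y - (\<Sum>\<^sup>+x. p x y)) * ennreal ((h y)\<^sup>2))"
  proof -
    have "(\<Sum>\<^sup>+x. \<Sum>\<^sup>+y. p x y * ennreal ((min (dist x y) (h x + h y))\<^sup>2))
        \<le> (\<Sum>\<^sup>+x. \<Sum>\<^sup>+y. p x y * ennreal ((dist x y)\<^sup>2))"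
      by (intro usum_mono mult_left_mono ennreal_leI power_mono) (auto simp: cutoff_nonneg h)
    then show ?thesis
      by (simp add: cost_def usum_option w_def usum_add add_mono add_ac)
  qed
  ultimately show ?thesis by blast
qed

section \<open>The partial transport pseudo-distance\<close>

text \<open>A family of finite point masses of which only finitely many in each bounded set are non-zero.\<close>

definition locally_finite :: "('a::metric_space \<Rightarrow> ennreal) \<Rightarrow> bool" where
  "locally_finite m \<longleftrightarrow> (\<forall>x. m x < \<top>) \<and> (\<forall>B. bounded B \<longrightarrow> finite {x \<in> B. m x \<noteq> 0})"

lemma locally_finite_less_top: "locally_finite m \<Longrightarrow> m x < \<top>"
  by (simp add: locally_finite_def)

lemma locally_finiteD: "locally_finite m \<Longrightarrow> bounded B \<Longrightarrow> finite {x \<in> B. m x \<noteq> 0}"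
  unfolding locally_finite_def by blast

lemma locally_finite_cutoff_support:
  assumes "locally_finite m" "cutoff h"
  shows "finite {x. m x \<noteq> 0 \<and> h x \<noteq> 0}"
proof -
  have "finite {x \<in> {x. h x \<noteq> 0}. m x \<noteq> 0}"
    using assms unfolding locally_finite_def cutoff_def by blast
  then show ?thesis by (rule rev_finite_subset) auto
qed

lemma usum_locally_finite_less_top:
  assumes m: "locally_finite m" and "bounded {x. f x \<noteq> 0}" and "\<And>x. f x < \<top>"
  shows "(\<Sum>\<^sup>+x. m x * f x) < \<top>"
proof -
  have fin: "finite {x \<in> {x. f x \<noteq> 0}. m x \<noteq> 0}"
    using assms unfolding locally_finite_def by blast
  have "(\<Sum>\<^sup>+x. m x * f x) = (\<Sum>x\<in>{x \<in> {x. f x \<noteq> 0}. m x \<noteq> 0}. m x * f x)"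
    by (rule usum_finite_support[OF fin]) auto
  also have "\<dots> < \<top>"
    using assms fin by (auto simp: locally_finite_less_top[OF m] ennreal_mult_less_top)
  finally show ?thesis .
qed

text \<open>The transport pseudo-distance with reservoir, the infimum of the square roots of the costs. Restricting
  to \<open>0 < r\<close> does not change the infimum. It is finite, since all mass may be sent to the reservoir.\<close>

definition partial_transport :: "('a::metric_space \<Rightarrow> real) \<Rightarrow> ('a \<Rightarrow> ennreal) \<Rightarrow> ('a \<Rightarrow> ennreal) \<Rightarrow> real" where
  "partial_transport h m1 m2 = Inf {r. 0 < r \<and> (\<exists>w. plan m1 m2 w \<and> cost h w \<le> ennreal (r\<^sup>2))}"

lemma partial_transport_leI:
  assumes "0 < r" "plan m1 m2 w" "cost h w \<le> ennreal (r\<^sup>2)"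
  shows "partial_transport h m1 m2 \<le> r"
  unfolding partial_transport_def
  using assms by (intro cInf_lower) (auto intro!: bdd_belowI[of _ 0])

lemma partial_transport_set_nonempty:
  fixes m1 m2 :: "'a::metric_space \<Rightarrow> ennreal"
  assumes h: "cutoff h" and m: "locally_finite m1" "locally_finite m2"
  shows "\<exists>r>0. \<exists>w. plan m1 m2 w \<and> cost h w \<le> ennreal (r\<^sup>2)"
proof -
  obtain w where w: "plan m1 m2 w"
    and c: "cost h w \<le> (\<Sum>\<^sup>+x. m1 x * ennreal ((h x)\<^sup>2)) + (\<Sum>\<^sup>+x. m2 x * ennreal ((h x)\<^sup>2))"
    using plan_of_partial[of "\<lambda>x y. 0" m1 m2 h] h by auto
  have "bounded {x. ennreal ((h x)\<^sup>2) \<noteq> 0}"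
    using h unfolding cutoff_def by (auto elim: bounded_subset)
  then have "cost h w < \<top>"
    using usum_locally_finite_less_top[OF m(1), of "\<lambda>x. ennreal ((h x)\<^sup>2)"]
      usum_locally_finite_less_top[OF m(2), of "\<lambda>x. ennreal ((h x)\<^sup>2)"] c
    by (auto intro: le_less_trans simp: ennreal_add_less_top)
  then obtain k where k: "0 \<le> k" "cost h w = ennreal k"
    by (cases "cost h w") auto
  have "k \<le> (k + 1)\<^sup>2" using k by (simp add: power2_eq_square algebra_simps)
  then show ?thesis using k w by (intro exI[of _ "k + 1"]) (auto intro!: ennreal_leI)
qed

lemma partial_transport_lessD:
  fixes m1 m2 :: "'a::metric_space \<Rightarrow> ennreal"
  assumes h: "cutoff h" and m: "locally_finite m1" "locally_finite m2"
    and less: "partial_transport h m1 m2 < r"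
  shows "0 < r \<and> (\<exists>w. plan m1 m2 w \<and> cost h w \<le> ennreal (r\<^sup>2))"
proof -
  obtain t where t: "t < r" "0 < t" and "\<exists>w. plan m1 m2 w \<and> cost h w \<le> ennreal (t\<^sup>2)"
    using cInf_lessD[OF _ less[unfolded partial_transport_def]] partial_transport_set_nonempty[OF h m]
    by blast
  moreover have "ennreal (t\<^sup>2) \<le> ennreal (r\<^sup>2)"
    using t by (intro ennreal_leI power_mono) auto
  ultimately show ?thesis by (meson order.strict_trans order_trans)
qed

lemma partial_transport_nonneg:
  fixes m1 m2 :: "'a::metric_space \<Rightarrow> ennreal"
  assumes h: "cutoff h" and m: "locally_finite m1" "locally_finite m2"
  shows "0 \<le> partial_transport h m1 m2"
  unfolding partial_transport_def
  using partial_transport_set_nonempty[OF h m] by (intro cInf_greatest) auto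

lemma partial_transport_commute: "partial_transport h m1 m2 = partial_transport h m2 m1"
proof -
  have "(\<exists>w. plan m1 m2 w \<and> cost h w \<le> c) = (\<exists>w. plan m2 m1 w \<and> cost h w \<le> c)" for c
    by (metis plan_transpose cost_transpose)
  then show ?thesis by (simp add: partial_transport_def)
qed

lemma partial_transport_self:
  fixes m :: "'a::metric_space \<Rightarrow> ennreal"
  assumes h: "cutoff h" and m: "locally_finite m"
  shows "partial_transport h m m = 0"
proof -
  define p where "p = (\<lambda>x y. if x = y then m x else 0)"
  have p: "(\<Sum>\<^sup>+y. p x y) = m x" "(\<Sum>\<^sup>+x. p x y) = m y" for x y
    by (subst usum_single[where x = x], simp_all add: p_def,
        subst usum_single[where x = y], simp_all add: p_def)
  have z: "p x y * ennreal ((dist x y)\<^sup>2) = 0" for x y by (simp add: p_def)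
  obtain w where w: "plan m m w" "cost h w \<le> 0"
    using plan_of_partial[of p m m h] h by (auto simp: p z locally_finite_less_top[OF m, THEN less_imp_neq])
  have "partial_transport h m m \<le> 0 + r" if "0 < r" for r
    using partial_transport_leI[OF that w(1), of h] w(2) by simp
  then have "partial_transport h m m \<le> 0" by (rule field_le_epsilon)
  then show ?thesis using partial_transport_nonneg[OF h m m] by simp
qed

lemma partial_transport_triangle:
  fixes m1 m2 m3 :: "'a::metric_space \<Rightarrow> ennreal"
  assumes h: "cutoff h" and m: "locally_finite m1" "locally_finite m2" "locally_finite m3"
  shows "partial_transport h m1 m3 \<le> partial_transport h m1 m2 + partial_transport h m2 m3"
proof (rule field_le_epsilon)
  fix e :: real assume e: "0 < e"
  let ?a = "partial_transport h m1 m2 + e / 2" and ?b = "partial_transport h m2 m3 + e / 2"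
  obtain u v where "plan m1 m2 u" "cost h u \<le> ennreal (?a\<^sup>2)" "plan m2 m3 v" "cost h v \<le> ennreal (?b\<^sup>2)"
      and pos: "0 < ?a" "0 < ?b"
    using partial_transport_lessD[OF h m(1,2), of ?a] partial_transport_lessD[OF h m(2,3), of ?b] e by auto
  then obtain w where "plan m1 m3 w" "cost h w \<le> ennreal ((?a + ?b)\<^sup>2)"
    using plan_glue[OF h, of m2] locally_finite_less_top[OF m(2)] by blast
  then have "partial_transport h m1 m3 \<le> ?a + ?b"
    using pos by (intro partial_transport_leI) auto
  then show "partial_transport h m1 m3 \<le> partial_transport h m1 m2 + partial_transport h m2 m3 + e"
    by simp
qed

section \<open>Nearby masses\<close>

text \<open>The tent function of height 1 and radius \<open>s\<close> around \<open>x\<close>.\<close>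

definition bump :: "real \<Rightarrow> 'a::metric_space \<Rightarrow> 'a \<Rightarrow> real" where
  "bump s x y = max 0 (1 - dist x y / s)"

lemma bump_nonneg: "0 \<le> bump s x y"
  by (simp add: bump_def)

lemma bump_le_1: "0 < s \<Longrightarrow> bump s x y \<le> 1"
  by (simp add: bump_def)

lemma bump_eq_0: "0 < s \<Longrightarrow> s \<le> dist x y \<Longrightarrow> bump s x y = 0"
  by (simp add: bump_def)

lemma bump_self [simp]: "bump s x x = 1"
  by (simp add: bump_def)

lemma sum_bump_le_1:
  assumes s: "0 < s" and F: "finite F"
    and disj: "\<And>x x'. x \<in> F \<Longrightarrow> x' \<in> F \<Longrightarrow> x \<noteq> x' \<Longrightarrow> 2 * s \<le> dist x x'"
  shows "(\<Sum>x\<in>F. bump s x y) \<le> 1"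
proof (cases "\<exists>x\<in>F. dist x y < s")
  case True
  then obtain x where x: "x \<in> F" "dist x y < s" by blast
  have "bump s x' y = 0" if "x' \<in> F - {x}" for x'
    using disj[of x x'] that x dist_triangle[of x x' y] s by (intro bump_eq_0) (auto simp: dist_commute)
  then have "(\<Sum>x\<in>F. bump s x y) = bump s x y"
    using F x by (simp add: sum.remove)
  then show ?thesis using bump_le_1[OF s] by simp
next
  case False
  then have "(\<Sum>x\<in>F. bump s x y) = 0" using s by (intro sum.neutral) (auto intro!: bump_eq_0)
  then show ?thesis by simp
qed

text \<open>The pseudo-distance from \<open>m0\<close> to \<open>m\<close> is controlled by integrals of continuous functions against \<open>m\<close>:
  the mass of \<open>m\<close> near a point \<open>x\<close> of \<open>m0\<close>, weighted by the tent function at \<open>x\<close>, is matched with the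
  mass at \<open>x\<close>, and everything else is matched with the reservoir.\<close>

lemma plan_to_nearby:
  fixes m0 m :: "'a::metric_space \<Rightarrow> ennreal"
  assumes h: "cutoff h" and H: "\<And>x. h x \<le> H"
    and m0: "locally_finite m0" and m: "locally_finite m"
    and F: "F = {x. m0 x \<noteq> 0 \<and> h x \<noteq> 0}"
    and s: "0 < s" and disj: "\<And>x x'. x \<in> F \<Longrightarrow> x' \<in> F \<Longrightarrow> x \<noteq> x' \<Longrightarrow> 2 * s \<le> dist x x'"
    and A: "\<And>x. x \<in> F \<Longrightarrow> (\<Sum>\<^sup>+y. m y * ennreal (bump s x y)) = ennreal (A x)" "\<And>x. x \<in> F \<Longrightarrow> 0 \<le> A x"
    and B: "(\<Sum>\<^sup>+y. m y * ennreal ((1 - (\<Sum>x\<in>F. bump s x y)) * (h y)\<^sup>2)) = ennreal B" "0 \<le> B"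
    and mu: "\<And>x. x \<in> F \<Longrightarrow> m0 x = ennreal (mu x)" "\<And>x. x \<in> F \<Longrightarrow> 0 \<le> mu x"
  shows "\<exists>w. plan m0 m w \<and>
    cost h w \<le> ennreal (s\<^sup>2 * (\<Sum>x\<in>F. mu x) + H\<^sup>2 * (\<Sum>x\<in>F. \<bar>A x - mu x\<bar>) + B)"
proof -
  have fin: "finite F" unfolding F by (rule locally_finite_cutoff_support[OF m0 h])
  have hH: "(h x)\<^sup>2 \<le> H\<^sup>2" for x using H[of x] cutoff_nonneg[OF h, of x] by (intro power_mono) auto
  \<comment> \<open>If there is more mass of \<open>m\<close> near \<open>x\<close> than \<open>m0\<close> has at \<open>x\<close>, only the fraction \<open>c x\<close> is used.\<close>
  define c where "c = (\<lambda>x. if A x \<le> mu x then 1 else mu x / A x)"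
  have c: "0 \<le> c x" "c x \<le> 1" "A x * c x = min (A x) (mu x)" if "x \<in> F" for x
    using A(2)[OF that] mu(2)[OF that] by (auto simp: c_def divide_simps)
  define p where "p = (\<lambda>x y. if x \<in> F then m y * ennreal (bump s x y * c x) else 0)"
  define S where "S = (\<lambda>y. \<Sum>x\<in>F. bump s x y * c x)"
  have S: "0 \<le> S y" "S y \<le> (\<Sum>x\<in>F. bump s x y)" "S y \<le> 1" for y
  proof -
    show "0 \<le> S y" unfolding S_def by (intro sum_nonneg mult_nonneg_nonneg bump_nonneg c)
    show 1: "S y \<le> (\<Sum>x\<in>F. bump s x y)" unfolding S_def
      by (intro sum_mono) (use c in \<open>auto intro!: mult_right_le_one_le bump_nonneg\<close>)
    show "S y \<le> 1" using sum_bump_le_1[OF s fin disj, of y] 1 by simp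
  qed
  have row: "(\<Sum>\<^sup>+y. p x y) = ennreal (min (A x) (mu x))" if x: "x \<in> F" for x
  proof -
    have "(\<Sum>\<^sup>+y. p x y) = (\<Sum>\<^sup>+y. m y * ennreal (bump s x y)) * ennreal (c x)"
      using x c[OF x] by (simp add: p_def ennreal_mult bump_nonneg mult.assoc[symmetric] usum_multc)
    also have "\<dots> = ennreal (A x * c x)"
      using A[OF x] c[OF x] ennreal_mult[of "A x" "c x"] by simp
    finally show ?thesis using c[OF x] by simp
  qed
  have row': "(\<Sum>\<^sup>+y. p x y) = 0" if "x \<notin> F" for x using that by (simp add: p_def)
  have col: "(\<Sum>\<^sup>+x. p x y) = m y * ennreal (S y)" for y
  proof -
    have "(\<Sum>\<^sup>+x. p x y) = (\<Sum>x\<in>F. m y * ennreal (bump s x y * c x))"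
      by (subst usum_finite_support[OF fin]) (auto simp: p_def)
    also have "\<dots> = m y * ennreal (S y)"
      unfolding S_def by (simp add: sum_distrib_left[symmetric] c bump_nonneg sum_ennreal)
    finally show ?thesis .
  qed
  have coldiff: "m y - m y * ennreal (S y) = m y * ennreal (1 - S y)" for y
  proof (cases "m y")
    case (real r)
    have "m y - m y * ennreal (S y) = ennreal (r - r * S y)"
      using real S[of y] by (simp add: ennreal_mult[symmetric] ennreal_minus)
    also have "r - r * S y = r * (1 - S y)" by (simp add: right_diff_distrib)
    also have "ennreal (r * (1 - S y)) = m y * ennreal (1 - S y)"
      unfolding real(2) by (rule ennreal_mult) (use real S[of y] in auto)
    finally show ?thesis .
  qed (use locally_finite_less_top[OF m, of y] in auto)
  have "\<exists>w. plan m0 m w \<and> cost h w \<le> (\<Sum>\<^sup>+x. \<Sum>\<^sup>+y. p x y * ennreal ((dist x y)\<^sup>2))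
      + (\<Sum>\<^sup>+x. (m0 x - (\<Sum>\<^sup>+y. p x y)) * ennreal ((h x)\<^sup>2))
      + (\<Sum>\<^sup>+y. (m y - (\<Sum>\<^sup>+x. p x y)) * ennreal ((h y)\<^sup>2))"
  proof (rule plan_of_partial[OF _ _ h])
    show "(\<Sum>\<^sup>+y. p x y) \<le> m0 x" for x
      by (cases "x \<in> F") (auto simp: row row' mu intro!: ennreal_leI)
    show "(\<Sum>\<^sup>+x. p x y) \<le> m y" for y
      unfolding col using mult_left_mono[OF ennreal_leI[OF S(3)], of "m y" y] by simp
  qed
  then obtain w where w: "plan m0 m w" and cw: "cost h w \<le> (\<Sum>\<^sup>+x. \<Sum>\<^sup>+y. p x y * ennreal ((dist x y)\<^sup>2))
      + (\<Sum>\<^sup>+x. (m0 x - (\<Sum>\<^sup>+y. p x y)) * ennreal ((h x)\<^sup>2))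
      + (\<Sum>\<^sup>+y. (m y - (\<Sum>\<^sup>+x. p x y)) * ennreal ((h y)\<^sup>2))" by blast
  have 1: "(\<Sum>\<^sup>+x. \<Sum>\<^sup>+y. p x y * ennreal ((dist x y)\<^sup>2)) \<le> ennreal (s\<^sup>2 * (\<Sum>x\<in>F. mu x))"
  proof -
    have "p x y * ennreal ((dist x y)\<^sup>2) \<le> p x y * ennreal (s\<^sup>2)" for x y
    proof (cases "dist x y < s")
      case True
      then show ?thesis by (intro mult_left_mono ennreal_leI power_mono) auto
    next
      case False
      then show ?thesis using s by (simp add: p_def bump_eq_0)
    qed
    then have "(\<Sum>\<^sup>+x. \<Sum>\<^sup>+y. p x y * ennreal ((dist x y)\<^sup>2)) \<le> (\<Sum>\<^sup>+x. \<Sum>\<^sup>+y. p x y * ennreal (s\<^sup>2))"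
      by (intro usum_mono)
    also have "\<dots> = (\<Sum>x\<in>F. (\<Sum>\<^sup>+y. p x y) * ennreal (s\<^sup>2))"
      unfolding usum_multc[of "p _"] by (rule usum_finite_support[OF fin]) (simp add: row')
    also have "\<dots> \<le> (\<Sum>x\<in>F. ennreal (s\<^sup>2 * mu x))"
      by (intro sum_mono) (auto simp: row ennreal_mult''[symmetric] mult.commute intro!: ennreal_leI mult_right_mono)
    also have "\<dots> = ennreal (s\<^sup>2 * (\<Sum>x\<in>F. mu x))"
      by (subst sum_ennreal) (auto simp: mu sum_distrib_left)
    finally show ?thesis .
  qed
  have 2: "(\<Sum>\<^sup>+x. (m0 x - (\<Sum>\<^sup>+y. p x y)) * ennreal ((h x)\<^sup>2))
      \<le> ennreal (H\<^sup>2 * (\<Sum>x\<in>F. mu x - min (A x) (mu x)))"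
  proof -
    have "(\<Sum>\<^sup>+x. (m0 x - (\<Sum>\<^sup>+y. p x y)) * ennreal ((h x)\<^sup>2))
        = (\<Sum>x\<in>F. (m0 x - (\<Sum>\<^sup>+y. p x y)) * ennreal ((h x)\<^sup>2))"
      by (rule usum_finite_support[OF fin]) (auto simp: F)
    also have "\<dots> = (\<Sum>x\<in>F. ennreal ((mu x - min (A x) (mu x)) * (h x)\<^sup>2))"
      by (intro sum.cong) (auto simp: row mu A ennreal_minus ennreal_mult)
    also have "\<dots> \<le> (\<Sum>x\<in>F. ennreal (H\<^sup>2 * (mu x - min (A x) (mu x))))"
      by (intro sum_mono ennreal_leI) (auto simp: mult.commute[of "H\<^sup>2"] intro!: mult_left_mono hH)
    also have "\<dots> = ennreal (H\<^sup>2 * (\<Sum>x\<in>F. mu x - min (A x) (mu x)))"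
      by (subst sum_ennreal) (auto simp: sum_distrib_left)
    finally show ?thesis .
  qed
  have 3: "(\<Sum>\<^sup>+y. (m y - (\<Sum>\<^sup>+x. p x y)) * ennreal ((h y)\<^sup>2))
      \<le> ennreal (B + H\<^sup>2 * (\<Sum>x\<in>F. A x - min (A x) (mu x)))"
  proof -
    have pt: "(1 - S y) * (h y)\<^sup>2 \<le> (1 - (\<Sum>x\<in>F. bump s x y)) * (h y)\<^sup>2 + (\<Sum>x\<in>F. bump s x y * (1 - c x) * H\<^sup>2)" for y
    proof -
      have "(1 - S y) * (h y)\<^sup>2 = (1 - (\<Sum>x\<in>F. bump s x y)) * (h y)\<^sup>2 + (\<Sum>x\<in>F. bump s x y * (1 - c x) * (h y)\<^sup>2)"
        by (simp add: S_def sum_distrib_right[symmetric] right_diff_distrib sum_subtractf left_diff_distrib)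
      also have "(\<Sum>x\<in>F. bump s x y * (1 - c x) * (h y)\<^sup>2) \<le> (\<Sum>x\<in>F. bump s x y * (1 - c x) * H\<^sup>2)"
        by (intro sum_mono mult_left_mono hH mult_nonneg_nonneg bump_nonneg) (auto simp: c)
      finally show ?thesis by simp
    qed
    have "(\<Sum>\<^sup>+y. (m y - (\<Sum>\<^sup>+x. p x y)) * ennreal ((h y)\<^sup>2)) = (\<Sum>\<^sup>+y. m y * ennreal ((1 - S y) * (h y)\<^sup>2))"
      unfolding col coldiff using S by (simp add: ennreal_mult mult.assoc)
    also have "\<dots> \<le> (\<Sum>\<^sup>+y. m y * ennreal ((1 - (\<Sum>x\<in>F. bump s x y)) * (h y)\<^sup>2 + (\<Sum>x\<in>F. bump s x y * (1 - c x) * H\<^sup>2)))"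
      by (intro usum_mono mult_left_mono ennreal_leI pt) auto
    also have "\<dots> = (\<Sum>\<^sup>+y. m y * ennreal ((1 - (\<Sum>x\<in>F. bump s x y)) * (h y)\<^sup>2)
        + (\<Sum>x\<in>F. m y * ennreal (bump s x y) * ennreal ((1 - c x) * H\<^sup>2)))"
    proof (intro nn_integral_cong)
      fix y
      have "ennreal ((1 - (\<Sum>x\<in>F. bump s x y)) * (h y)\<^sup>2 + (\<Sum>x\<in>F. bump s x y * (1 - c x) * H\<^sup>2))
          = ennreal ((1 - (\<Sum>x\<in>F. bump s x y)) * (h y)\<^sup>2) + ennreal (\<Sum>x\<in>F. bump s x y * (1 - c x) * H\<^sup>2)"
        using sum_bump_le_1[OF s fin disj, of y]
        by (intro ennreal_plus) (auto intro!: sum_nonneg mult_nonneg_nonneg bump_nonneg simp: c)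
      also have "ennreal (\<Sum>x\<in>F. bump s x y * (1 - c x) * H\<^sup>2) = (\<Sum>x\<in>F. ennreal (bump s x y) * ennreal ((1 - c x) * H\<^sup>2))"
        by (subst sum_ennreal[symmetric]) (auto simp: c bump_nonneg ennreal_mult[symmetric] mult.assoc)
      finally show "m y * ennreal ((1 - (\<Sum>x\<in>F. bump s x y)) * (h y)\<^sup>2 + (\<Sum>x\<in>F. bump s x y * (1 - c x) * H\<^sup>2))
          = m y * ennreal ((1 - (\<Sum>x\<in>F. bump s x y)) * (h y)\<^sup>2)
        + (\<Sum>x\<in>F. m y * ennreal (bump s x y) * ennreal ((1 - c x) * H\<^sup>2))"
        by (simp add: distrib_left sum_distrib_left mult.assoc)
    qed
    also have "\<dots> = ennreal B + (\<Sum>x\<in>F. ennreal (A x) * ennreal ((1 - c x) * H\<^sup>2))"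
      by (simp add: usum_add usum_sum usum_multc B A)
    also have "(\<Sum>x\<in>F. ennreal (A x) * ennreal ((1 - c x) * H\<^sup>2)) = (\<Sum>x\<in>F. ennreal (H\<^sup>2 * (A x - min (A x) (mu x))))"
    proof (intro sum.cong refl)
      fix x assume x: "x \<in> F"
      have "ennreal (A x) * ennreal ((1 - c x) * H\<^sup>2) = ennreal (A x * ((1 - c x) * H\<^sup>2))"
        by (rule ennreal_mult[symmetric]) (use A c x in auto)
      also have "A x * ((1 - c x) * H\<^sup>2) = H\<^sup>2 * (A x - min (A x) (mu x))"
        unfolding c(3)[OF x, symmetric] by (simp add: algebra_simps)
      finally show "ennreal (A x) * ennreal ((1 - c x) * H\<^sup>2) = ennreal (H\<^sup>2 * (A x - min (A x) (mu x)))" .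
    qed
    also have "\<dots> = ennreal (H\<^sup>2 * (\<Sum>x\<in>F. A x - min (A x) (mu x)))"
      by (subst sum_ennreal) (auto simp: sum_distrib_left)
    also have "ennreal B + \<dots> = ennreal (B + H\<^sup>2 * (\<Sum>x\<in>F. A x - min (A x) (mu x)))"
      by (rule ennreal_plus[symmetric]) (auto simp: B intro!: mult_nonneg_nonneg sum_nonneg)
    finally show ?thesis .
  qed
  have "cost h w \<le> ennreal (s\<^sup>2 * (\<Sum>x\<in>F. mu x)) + ennreal (H\<^sup>2 * (\<Sum>x\<in>F. mu x - min (A x) (mu x)))
      + ennreal (B + H\<^sup>2 * (\<Sum>x\<in>F. A x - min (A x) (mu x)))"
    using cw 1 2 3 by (meson add_mono order_trans)
  also have "\<dots> = ennreal (s\<^sup>2 * (\<Sum>x\<in>F. mu x) + H\<^sup>2 * (\<Sum>x\<in>F. mu x - min (A x) (mu x))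
      + (B + H\<^sup>2 * (\<Sum>x\<in>F. A x - min (A x) (mu x))))"
    using B by (simp add: sum_nonneg mu)
  also have "s\<^sup>2 * (\<Sum>x\<in>F. mu x) + H\<^sup>2 * (\<Sum>x\<in>F. mu x - min (A x) (mu x))
      + (B + H\<^sup>2 * (\<Sum>x\<in>F. A x - min (A x) (mu x)))
      = s\<^sup>2 * (\<Sum>x\<in>F. mu x) + H\<^sup>2 * (\<Sum>x\<in>F. (mu x - min (A x) (mu x)) + (A x - min (A x) (mu x))) + B"
    by (simp only: sum.distrib distrib_left)
  also have "(\<Sum>x\<in>F. (mu x - min (A x) (mu x)) + (A x - min (A x) (mu x))) = (\<Sum>x\<in>F. \<bar>A x - mu x\<bar>)"
    by (intro sum.cong) auto
  finally show ?thesis using w by blast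
qed

text \<open>A plan of small cost changes the integral of a continuous function \<open>f\<close> only a little, if the support of
  \<open>f\<close> stays at height at least 1 above the reservoir: short moves start at one of finitely many points,
  at which \<open>f\<close> varies little, and by Chebyshev's inequality long moves carry little mass.\<close>

lemma integral_close_of_plan:
  fixes m0 :: "'a::metric_space \<Rightarrow> ennreal"
  assumes h: "cutoff h" and m0: "locally_finite m0"
    and f: "continuous_on UNIV f" "\<And>x. 0 \<le> f x" "\<And>x. f x \<le> K" and supp: "\<And>x. f x \<noteq> 0 \<Longrightarrow> 1 \<le> h x"
    and e: "0 < e"
  shows "\<exists>r>0. \<forall>m w. plan m0 m w \<and> cost h w \<le> ennreal (r\<^sup>2) \<longrightarrow>
     (\<Sum>\<^sup>+x. m x * ennreal (f x)) \<le> (\<Sum>\<^sup>+x. m0 x * ennreal (f x)) + ennreal e \<and>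
     (\<Sum>\<^sup>+x. m0 x * ennreal (f x)) \<le> (\<Sum>\<^sup>+x. m x * ennreal (f x)) + ennreal e"
proof -
  define F where "F = {x. m0 x \<noteq> 0 \<and> h x \<noteq> 0}"
  have fin: "finite F" unfolding F_def by (rule locally_finite_cutoff_support[OF m0 h])
  have K: "0 \<le> K" using f(2,3) order_trans by blast
  have "(\<Sum>x\<in>F. m0 x) < \<top>" using fin by (simp add: locally_finite_less_top[OF m0])
  then obtain N where N: "0 \<le> N" "(\<Sum>x\<in>F. m0 x) = ennreal N" by (cases "\<Sum>x\<in>F. m0 x") auto
  define e' where "e' = e / (2 * (N + 1))"
  have e': "0 < e'" "e' * N \<le> e / 2" using e N by (auto simp: e'_def field_simps)
  have "\<forall>\<^sub>F s in at_right 0. \<forall>y. dist x y < s \<longrightarrow> \<bar>f x - f y\<bar> \<le> e'" for x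
  proof -
    obtain d where d: "d > 0" "\<And>y. dist y x < d \<Longrightarrow> dist (f y) (f x) < e'"
      using f(1) e' unfolding continuous_on_iff by (metis UNIV_I)
    show ?thesis unfolding eventually_at_right_field
      using d by (intro exI[of _ d]) (auto simp: dist_real_def dist_commute abs_minus_commute less_imp_le)
  qed
  then have "\<forall>\<^sub>F s in at_right 0. \<forall>x\<in>F. \<forall>y. dist x y < s \<longrightarrow> \<bar>f x - f y\<bar> \<le> e'"
    using fin by (intro eventually_ball_finite) auto
  moreover have "\<forall>\<^sub>F s::real in at_right 0. s < 1" "\<forall>\<^sub>F s::real in at_right 0. 0 < s"
    by (auto simp: eventually_at_right_field intro: exI[of _ 1])
  ultimately have "\<forall>\<^sub>F s in at_right 0. (\<forall>x\<in>F. \<forall>y. dist x y < s \<longrightarrow> \<bar>f x - f y\<bar> \<le> e') \<and> s < 1 \<and> 0 < s"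
    by eventually_elim auto
  then obtain s where s: "\<And>x y. x \<in> F \<Longrightarrow> dist x y < s \<Longrightarrow> \<bar>f x - f y\<bar> \<le> e'" "s < 1" "0 < s"
    using eventually_happens'[OF trivial_limit_at_right_real] by blast
  define g where "g = case_option 0 f"
  have g: "0 \<le> g a" "g a \<le> K" for a using f K by (auto simp: g_def split: option.split)
  define r where "r = s * sqrt (e / (2 * (K + 1)))"
  have r: "0 < r" using s e K by (simp add: r_def)
  have Kr: "K / s\<^sup>2 * r\<^sup>2 \<le> e / 2"
  proof -
    have "K / s\<^sup>2 * r\<^sup>2 = K * (e / (2 * (K + 1)))" using s e K by (simp add: r_def power_mult_distrib)
    also have "\<dots> \<le> e / 2" using e K by (simp add: field_simps)
    finally show ?thesis .
  qed
  show ?thesis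
  proof (intro exI[of _ r] conjI r allI impI; elim conjE)
    fix m w assume w: "plan m0 m w" and c: "cost h w \<le> ennreal (r\<^sup>2)"
    define E where "E = (\<Sum>\<^sup>+a. \<Sum>\<^sup>+b. w a b * ennreal \<bar>g a - g b\<bar>)"
    have M0: "(\<Sum>\<^sup>+a. \<Sum>\<^sup>+b. w a b * ennreal (g a)) = (\<Sum>\<^sup>+x. m0 x * ennreal (f x))"
      using w unfolding usum_multc by (subst usum_option) (simp add: g_def plan_def)
    have M: "(\<Sum>\<^sup>+a. \<Sum>\<^sup>+b. w a b * ennreal (g b)) = (\<Sum>\<^sup>+x. m x * ennreal (f x))"
      using w by (subst usum_swap, unfold usum_multc, subst usum_option) (simp add: g_def plan_def)
    have "(\<Sum>\<^sup>+a. \<Sum>\<^sup>+b. w a b * ennreal (g b)) \<le> (\<Sum>\<^sup>+a. \<Sum>\<^sup>+b. w a b * (ennreal (g a) + ennreal \<bar>g a - g b\<bar>))"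
      by (intro usum_mono mult_left_mono) (auto simp: ennreal_plus[symmetric] g simp del: ennreal_plus intro!: ennreal_leI)
    then have 1: "(\<Sum>\<^sup>+x. m x * ennreal (f x)) \<le> (\<Sum>\<^sup>+x. m0 x * ennreal (f x)) + E"
      by (simp add: distrib_left usum_add M M0 E_def)
    have "(\<Sum>\<^sup>+a. \<Sum>\<^sup>+b. w a b * ennreal (g a)) \<le> (\<Sum>\<^sup>+a. \<Sum>\<^sup>+b. w a b * (ennreal (g b) + ennreal \<bar>g a - g b\<bar>))"
      by (intro usum_mono mult_left_mono) (auto simp: ennreal_plus[symmetric] g simp del: ennreal_plus intro!: ennreal_leI)
    then have 2: "(\<Sum>\<^sup>+x. m0 x * ennreal (f x)) \<le> (\<Sum>\<^sup>+x. m x * ennreal (f x)) + E"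
      by (simp add: distrib_left usum_add M M0 E_def)
    \<comment> \<open>The first term on the right bounds the short moves, the second one the long moves.\<close>
    have pt: "w a b * ennreal \<bar>g a - g b\<bar>
        \<le> w a b * (ennreal e' * indicator (Some ` F) a) + w a b * (ennreal (K / s\<^sup>2) * ennreal ((res_dist h a b)\<^sup>2))" for a b
    proof (cases "s \<le> res_dist h a b \<or> w a b = 0")
      case True
      show ?thesis
      proof (cases "w a b = 0")
        case False
        with True have "s\<^sup>2 \<le> (res_dist h a b)\<^sup>2" using s by (intro power_mono) auto
        then have "K \<le> K / s\<^sup>2 * (res_dist h a b)\<^sup>2" using K s by (simp add: field_simps mult_left_mono)
        moreover have "\<bar>g a - g b\<bar> \<le> K" using g[of a] g[of b] by auto
        ultimately have "ennreal \<bar>g a - g b\<bar> \<le> ennreal (K / s\<^sup>2) * ennreal ((res_dist h a b)\<^sup>2)"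
          using K by (subst ennreal_mult[symmetric]) (auto intro!: ennreal_leI)
        then have "w a b * ennreal \<bar>g a - g b\<bar> \<le> w a b * (ennreal (K / s\<^sup>2) * ennreal ((res_dist h a b)\<^sup>2))"
          by (rule mult_left_mono) simp
        then show ?thesis by (rule order_trans) simp
      qed simp
    next
      case False
      then have near: "res_dist h a b < s" and w0: "w a b \<noteq> 0" by auto
      have "g a = g b \<or> (a \<in> Some ` F \<and> \<bar>g a - g b\<bar> \<le> e')"
      proof (cases a)
        case None
        show ?thesis
        proof (cases b)
          case (Some y)
          then have "f y = 0" using near None s supp[of y] by auto
          then show ?thesis using None Some by (simp add: g_def)
        qed (simp add: None)
      next
        case a: (Some x)
        show ?thesis
        proof (cases b)
          case None
          then have "f x = 0" using near a s supp[of x] by auto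
          then show ?thesis using None a by (simp add: g_def)
        next
          case b: (Some y)
          show ?thesis
          proof (cases "h x + h y < s")
            case True
            then have "h x < 1" "h y < 1" using s cutoff_nonneg[OF h, of x] cutoff_nonneg[OF h, of y] by auto
            then have "f x = 0" "f y = 0" using supp[of x] supp[of y] by auto
            then show ?thesis by (simp add: a b g_def)
          next
            case False
            then have d: "dist x y < s" using near a b by auto
            show ?thesis
            proof (cases "h x = 0")
              case True
              then have "h y < 1" using cutoff_lipschitz[OF h, of y x] d s by (simp add: dist_commute)
              then have "f x = 0" "f y = 0" using supp[of x] supp[of y] True by fastforce+
              then show ?thesis by (simp add: a b g_def)
            next
              case False
              moreover have "m0 x \<noteq> 0" using plan_le_left[OF w, of x b] w0 a by auto
              ultimately have "x \<in> F" by (simp add: F_def)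
              then show ?thesis using s(1)[OF _ d] by (simp add: a b g_def)
            qed
          qed
        qed
      qed
      then have "ennreal \<bar>g a - g b\<bar> \<le> ennreal e' * indicator (Some ` F) a"
        by (auto intro!: ennreal_leI)
      then have "w a b * ennreal \<bar>g a - g b\<bar> \<le> w a b * (ennreal e' * indicator (Some ` F) a)"
        by (rule mult_left_mono) simp
      then show ?thesis by (rule order_trans) simp
    qed
    have "E \<le> (\<Sum>\<^sup>+a. \<Sum>\<^sup>+b. w a b * (ennreal e' * indicator (Some ` F) a)
        + w a b * (ennreal (K / s\<^sup>2) * ennreal ((res_dist h a b)\<^sup>2)))"
      unfolding E_def by (intro usum_mono pt)
    also have "\<dots> = (\<Sum>\<^sup>+a. (\<Sum>\<^sup>+b. w a b) * (ennreal e' * indicator (Some ` F) a)) + ennreal (K / s\<^sup>2) * cost h w"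
      unfolding usum_add cost_def mult.left_commute[of _ "ennreal (K / s\<^sup>2)"] usum_cmult usum_multc
      by (rule refl)
    also have "(\<Sum>\<^sup>+a. (\<Sum>\<^sup>+b. w a b) * (ennreal e' * indicator (Some ` F) a))
        = (\<Sum>a\<in>Some ` F. (\<Sum>\<^sup>+b. w a b) * (ennreal e' * indicator (Some ` F) a))"
      by (rule usum_finite_support) (auto simp: fin split: split_indicator)
    also have "\<dots> = (\<Sum>x\<in>F. m0 x * ennreal e')"
      using w by (subst sum.reindex) (auto simp: plan_def intro!: sum.cong)
    also have "\<dots> = ennreal (e' * N)"
      using N e' by (simp add: sum_distrib_right[symmetric] ennreal_mult mult.commute[of e'])
    also have "ennreal (K / s\<^sup>2) * cost h w \<le> ennreal (K / s\<^sup>2) * ennreal (r\<^sup>2)"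
      by (intro mult_left_mono c) auto
    also have "\<dots> = ennreal (K / s\<^sup>2 * r\<^sup>2)" by (rule ennreal_mult[symmetric]) (use K in auto)
    also have "ennreal (e' * N) + \<dots> \<le> ennreal (e / 2) + ennreal (e / 2)"
      using Kr e' by (intro add_mono ennreal_leI) auto
    also have "\<dots> = ennreal e" using e by (simp flip: ennreal_plus)
    finally have E: "E \<le> ennreal e" by simp
    show "(\<Sum>\<^sup>+x. m x * ennreal (f x)) \<le> (\<Sum>\<^sup>+x. m0 x * ennreal (f x)) + ennreal e"
      using 1 E by (meson add_left_mono order_trans)
    show "(\<Sum>\<^sup>+x. m0 x * ennreal (f x)) \<le> (\<Sum>\<^sup>+x. m x * ennreal (f x)) + ennreal e"
      using 2 E by (meson add_left_mono order_trans)
  qed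
qed

section \<open>Letting the reservoir recede\<close>

lemma usum_Fatou:
  fixes f :: "nat \<Rightarrow> 'b \<Rightarrow> ennreal"
  assumes "\<And>x. (\<lambda>n. f n x) \<longlonglongrightarrow> l x" and "\<And>n. (\<Sum>\<^sup>+x. f n x) \<le> C"
  shows "(\<Sum>\<^sup>+x. l x) \<le> C"
proof -
  have "(\<Sum>\<^sup>+x. l x) = (\<Sum>\<^sup>+x. liminf (\<lambda>n. f n x))"
    using lim_imp_Liminf[OF trivial_limit_sequentially assms(1)] by simp
  also have "\<dots> \<le> liminf (\<lambda>n. \<Sum>\<^sup>+x. f n x)"
    by (rule nn_integral_liminf) auto
  also have "\<dots> \<le> limsup (\<lambda>n. \<Sum>\<^sup>+x. f n x)"
    by (rule Liminf_le_Limsup) simp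
  also have "\<dots> \<le> C"
    using assms(2) by (intro Limsup_bounded) auto
  finally show ?thesis .
qed

text \<open>No mass is lost in the limit: as the reservoir recedes, a bound on the costs keeps the mass that leaves \<open>x\<close>
  within a distance \<open>D\<close>, where it has finitely many destinations, up to an error \<open>C / D\<^sup>2\<close>.\<close>

lemma plan_limit_row:
  fixes w :: "nat \<Rightarrow> 'a::metric_space option \<Rightarrow> 'a option \<Rightarrow> ennreal"
  assumes m2: "locally_finite m2" and h: "\<And>n. cutoff (h n)"
    and h_lim: "\<And>x. filterlim (\<lambda>n. h n x) at_top sequentially"
    and w: "\<And>n. plan m1 m2 (w n)" and C: "\<And>n. cost (h n) (w n) \<le> ennreal C" "0 \<le> C"
    and lim: "\<And>x y. (\<lambda>n. w n (Some x) (Some y)) \<longlonglongrightarrow> l x y"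
  shows "(\<Sum>\<^sup>+y. l x y) = m1 x"
proof (rule antisym)
  show "(\<Sum>\<^sup>+y. l x y) \<le> m1 x"
  proof (rule usum_Fatou[OF lim])
    fix n
    have "(\<Sum>\<^sup>+y. w n (Some x) (Some y)) \<le> (\<Sum>\<^sup>+b. w n (Some x) b)"
      by (simp add: usum_option)
    then show "(\<Sum>\<^sup>+y. w n (Some x) (Some y)) \<le> m1 x"
      using w by (simp add: plan_def)
  qed
next
  have far: "m1 x \<le> (\<Sum>\<^sup>+y. l x y) + ennreal (C / D\<^sup>2)" if D: "0 < D" for D :: real
  proof -
    define F where "F = {y \<in> ball x D. m2 y \<noteq> 0}"
    have fin: "finite F" unfolding F_def by (rule locally_finiteD[OF m2 bounded_ball])
    have "\<forall>\<^sub>F n in sequentially. D \<le> h n x"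
      using h_lim[of x] by (simp add: filterlim_at_top)
    then have "\<forall>\<^sub>F n in sequentially. m1 x \<le> (\<Sum>y\<in>F. w n (Some x) (Some y)) + ennreal (C / D\<^sup>2)"
    proof eventually_elim
      fix n assume n: "D \<le> h n x"
      let ?w = "w n (Some x)"
      have pt: "?w b \<le> ?w b * indicator (Some ` F) b + ennreal (1 / D\<^sup>2) * (?w b * ennreal ((res_dist (h n) (Some x) b)\<^sup>2))" for b
      proof (cases "b \<in> Some ` F \<or> ?w b = 0")
        case False
        have "D \<le> res_dist (h n) (Some x) b"
        proof (cases b)
          case (Some y)
          with False plan_le_right[OF w, of n "Some x" y] have "m2 y \<noteq> 0" by auto
          then have "D \<le> dist x y" using False Some by (auto simp: F_def)
          then show ?thesis using Some n cutoff_nonneg[OF h, of n y] by simp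
        qed (simp add: n)
        then have "D\<^sup>2 \<le> (res_dist (h n) (Some x) b)\<^sup>2" using D by (intro power_mono) auto
        then have "1 \<le> 1 / D\<^sup>2 * (res_dist (h n) (Some x) b)\<^sup>2" using D by (simp add: field_simps)
        then have "ennreal 1 \<le> ennreal (1 / D\<^sup>2 * (res_dist (h n) (Some x) b)\<^sup>2)"
          by (rule ennreal_leI)
        also have "\<dots> = ennreal (1 / D\<^sup>2) * ennreal ((res_dist (h n) (Some x) b)\<^sup>2)"
          by (rule ennreal_mult) auto
        finally have "?w b * 1 \<le> ?w b * (ennreal (1 / D\<^sup>2) * ennreal ((res_dist (h n) (Some x) b)\<^sup>2))"
          by (intro mult_left_mono) auto
        also have "\<dots> = ennreal (1 / D\<^sup>2) * (?w b * ennreal ((res_dist (h n) (Some x) b)\<^sup>2))"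
          by (rule mult.left_commute)
        finally show ?thesis by (simp add: add_increasing)
      qed auto
      have "m1 x = (\<Sum>\<^sup>+b. ?w b)" using w by (simp add: plan_def)
      also have "\<dots> \<le> (\<Sum>\<^sup>+b. ?w b * indicator (Some ` F) b
          + ennreal (1 / D\<^sup>2) * (?w b * ennreal ((res_dist (h n) (Some x) b)\<^sup>2)))"
        by (intro usum_mono pt)
      also have "\<dots> = (\<Sum>\<^sup>+b. ?w b * indicator (Some ` F) b)
          + ennreal (1 / D\<^sup>2) * (\<Sum>\<^sup>+b. ?w b * ennreal ((res_dist (h n) (Some x) b)\<^sup>2))"
        unfolding usum_add usum_cmult by (rule refl)
      also have "(\<Sum>\<^sup>+b. ?w b * indicator (Some ` F) b) = (\<Sum>b\<in>Some ` F. ?w b * indicator (Some ` F) b)"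
        by (rule usum_finite_support) (auto simp: fin split: split_indicator)
      also have "\<dots> = (\<Sum>y\<in>F. ?w (Some y))"
        by (subst sum.reindex) auto
      also have "(\<Sum>\<^sup>+b. ?w b * ennreal ((res_dist (h n) (Some x) b)\<^sup>2)) \<le> cost (h n) (w n)"
        unfolding cost_def by (rule usum_ge_point)
      also have "\<dots> \<le> ennreal C" by (rule C)
      also have "ennreal (1 / D\<^sup>2) * ennreal C = ennreal (1 / D\<^sup>2 * C)"
        by (rule ennreal_mult[symmetric]) (use C in auto)
      finally show "m1 x \<le> (\<Sum>y\<in>F. ?w (Some y)) + ennreal (C / D\<^sup>2)"
        by (simp add: add_left_mono mult_left_mono)
    qed
    moreover have "(\<lambda>n. (\<Sum>y\<in>F. w n (Some x) (Some y)) + ennreal (C / D\<^sup>2))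
        \<longlonglongrightarrow> (\<Sum>y\<in>F. l x y) + ennreal (C / D\<^sup>2)"
      by (intro tendsto_intros lim)
    ultimately have "m1 x \<le> (\<Sum>y\<in>F. l x y) + ennreal (C / D\<^sup>2)"
      by (intro tendsto_lowerbound[where F = sequentially]) auto
    also have "(\<Sum>y\<in>F. l x y) = (\<Sum>y\<in>F. l x y * indicator F y)"
      by (intro sum.cong) auto
    also have "\<dots> = (\<Sum>\<^sup>+y. l x y * indicator F y)"
      by (rule usum_finite_support[symmetric]) (auto simp: fin)
    also have "\<dots> \<le> (\<Sum>\<^sup>+y. l x y)"
      by (intro usum_mono) (auto split: split_indicator)
    finally show ?thesis by (simp add: add_right_mono)
  qed
  show "m1 x \<le> (\<Sum>\<^sup>+y. l x y)"
  proof (rule ennreal_le_epsilon)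
    fix e :: real assume e: "0 < e"
    have "C / (sqrt (C / e + 1))\<^sup>2 \<le> e" using C e by (simp add: field_simps)
    then have "ennreal (C / (sqrt (C / e + 1))\<^sup>2) \<le> ennreal e" by (rule ennreal_leI)
    moreover have "0 < sqrt (C / e + 1)" using C e by (simp add: add_nonneg_pos)
    ultimately show "m1 x \<le> (\<Sum>\<^sup>+y. l x y) + ennreal e"
      using far[of "sqrt (C / e + 1)"] by (meson add_left_mono order_trans)
  qed
qed

lemma locally_finite_countable_support:
  assumes "locally_finite m"
  shows "countable {x. m x \<noteq> 0}"
proof -
  have "{x. m x \<noteq> 0} = (\<Union>n::nat. {x \<in> ball undefined (real n). m x \<noteq> 0})"
    using reals_Archimedean2 by fastforce
  moreover have "countable \<dots>"
    using assms by (intro countable_UN) (auto simp: locally_finite_def intro!: countable_finite)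
  ultimately show ?thesis by simp
qed

text \<open>If plans of bounded cost exist for cut-offs that tend to infinity, then a subsequence converges to a
  coupling of the full masses whose cost for the original distance obeys the same bound.\<close>

lemma plan_limit:
  fixes h :: "nat \<Rightarrow> 'a::metric_space \<Rightarrow> real"
  assumes m1: "locally_finite m1" and m2: "locally_finite m2" and h: "\<And>n. cutoff (h n)"
    and h_lim: "\<And>x. filterlim (\<lambda>n. h n x) at_top sequentially"
    and C: "0 \<le> C" and ex: "\<And>n. \<exists>w. plan m1 m2 w \<and> cost (h n) w \<le> ennreal C"
  shows "\<exists>l. (\<forall>x. (\<Sum>\<^sup>+y. l x y) = m1 x) \<and> (\<forall>y. (\<Sum>\<^sup>+x. l x y) = m2 y) \<and>
    (\<Sum>\<^sup>+x. \<Sum>\<^sup>+y. l x y * ennreal ((dist x y)\<^sup>2)) \<le> ennreal C"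
proof -
  obtain w where w: "\<And>n. plan m1 m2 (w n)" and cw: "\<And>n. cost (h n) (w n) \<le> ennreal C"
    using ex by metis
  define S where "S = {x. m1 x \<noteq> 0} \<times> {y. m2 y \<noteq> 0}"
  have S: "countable S"
    unfolding S_def by (intro countable_SIGMA locally_finite_countable_support m1 m2)
  \<comment> \<open>Dividing by \<open>m1 x\<close> bounds all weights by 1, as the diagonal argument requires.\<close>
  define f where "f = (\<lambda>n (x, y). enn2real (w n (Some x) (Some y)) / enn2real (m1 x))"
  have "norm (f n p) \<le> 1" if "p \<in> S" for n p
  proof -
    obtain x y where p: "p = (x, y)" by (cases p)
    have "enn2real (w n (Some x) (Some y)) \<le> enn2real (m1 x)"
      by (intro enn2real_mono plan_le_left[OF w] locally_finite_less_top[OF m1])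
    then show ?thesis
      using divide_right_mono[of "enn2real (w n (Some x) (Some y))" "enn2real (m1 x)" "enn2real (m1 x)"]
      by (cases "enn2real (m1 x) = 0") (auto simp: f_def p)
  qed
  then obtain k where k: "strict_mono k" and kl: "\<And>p. p \<in> S \<Longrightarrow> \<exists>l. (\<lambda>n. f (k n) p) \<longlonglongrightarrow> l"
    using function_convergent_subsequence[OF S, of f 1] by metis
  obtain L where L: "\<And>p. p \<in> S \<Longrightarrow> (\<lambda>n. f (k n) p) \<longlonglongrightarrow> L p"
    using kl by metis
  define l where "l = (\<lambda>x y. if (x, y) \<in> S then ennreal (enn2real (m1 x) * L (x, y)) else 0)"
  have lim: "(\<lambda>n. w (k n) (Some x) (Some y)) \<longlonglongrightarrow> l x y" for x y
  proof (cases "(x, y) \<in> S")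
    case True
    have *: "w n (Some x) (Some y) = ennreal (enn2real (m1 x) * f n (x, y))" for n
    proof -
      have "w n (Some x) (Some y) < \<top>"
        using plan_le_left[OF w] locally_finite_less_top[OF m1] by (rule le_less_trans)
      moreover have "enn2real (m1 x) \<noteq> 0"
        using True locally_finite_less_top[OF m1, of x] by (auto simp: S_def enn2real_eq_0_iff)
      ultimately show ?thesis by (simp add: f_def)
    qed
    show ?thesis unfolding * using True by (auto simp: l_def intro!: tendsto_intros L)
  next
    case False
    then have "w n (Some x) (Some y) = 0" for n
      using plan_le_left[OF w, of n x "Some y"] plan_le_right[OF w, of n "Some x" y] by (auto simp: S_def)
    then show ?thesis using False by (simp add: l_def)
  qed
  have h_lim': "filterlim (\<lambda>n. h (k n) x) at_top sequentially" for x
    by (rule filterlim_compose[OF h_lim filterlim_subseq[OF k]])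
  define wT where "wT = (\<lambda>n a b. w (k n) b a)"
  have wT: "plan m2 m1 (wT n)" and cwT: "cost (h (k n)) (wT n) \<le> ennreal C" for n
    using plan_transpose[OF w] cw cost_transpose[of "h (k n)" "w (k n)"] by (simp_all add: wT_def)
  define lT where "lT = (\<lambda>y x. l x y)"
  have limT: "(\<lambda>n. wT n (Some y) (Some x)) \<longlonglongrightarrow> lT y x" for x y
    using lim by (simp add: wT_def lT_def)
  have colT: "(\<Sum>\<^sup>+x. lT y x) = m2 y" for y
    by (rule plan_limit_row[OF m1 h h_lim' wT cwT C limT])
  show ?thesis
  proof (intro exI[of _ l] conjI allI)
    show "(\<Sum>\<^sup>+y. l x y) = m1 x" for x
      by (rule plan_limit_row[OF m2 h h_lim' w cw C lim])
    show "(\<Sum>\<^sup>+x. l x y) = m2 y" for y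
      using colT[of y] by (simp add: lT_def)
    have "(\<Sum>\<^sup>+p. l (fst p) (snd p) * ennreal ((dist (fst p) (snd p))\<^sup>2)) \<le> ennreal C"
    proof (rule usum_Fatou)
      fix p :: "'a \<times> 'a"
      obtain x y where p: "p = (x, y)" by (cases p)
      have "(\<lambda>n. w (k n) (Some x) (Some y) * ennreal ((dist x y)\<^sup>2)) \<longlonglongrightarrow> l x y * ennreal ((dist x y)\<^sup>2)"
        using ennreal_tendsto_cmult[OF _ lim, of "ennreal ((dist x y)\<^sup>2)"] by (simp add: mult.commute)
      moreover have "\<forall>\<^sub>F n in sequentially. dist x y \<le> h (k n) x"
        using h_lim'[of x] by (simp add: filterlim_at_top)
      then have "\<forall>\<^sub>F n in sequentially. w (k n) (Some x) (Some y) * ennreal ((dist x y)\<^sup>2)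
          = w (k n) (Some x) (Some y) * ennreal ((res_dist (h (k n)) (Some x) (Some y))\<^sup>2)"
      proof eventually_elim
        case (elim n)
        then show ?case using cutoff_nonneg[OF h, of "k n" y] by (simp add: min_absorb1)
      qed
      ultimately show "(\<lambda>n. w (k n) (Some (fst p)) (Some (snd p)) * ennreal ((res_dist (h (k n)) (Some (fst p)) (Some (snd p)))\<^sup>2))
          \<longlonglongrightarrow> l (fst p) (snd p) * ennreal ((dist (fst p) (snd p))\<^sup>2)"
        unfolding p fst_conv snd_conv by (rule Lim_transform_eventually)
    next
      fix n
      have "(\<Sum>\<^sup>+p. w (k n) (Some (fst p)) (Some (snd p)) * ennreal ((res_dist (h (k n)) (Some (fst p)) (Some (snd p)))\<^sup>2))
          = (\<Sum>\<^sup>+x. \<Sum>\<^sup>+y. w (k n) (Some x) (Some y) * ennreal ((res_dist (h (k n)) (Some x) (Some y))\<^sup>2))"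
        by (rule usum_pair[symmetric])
      also have "\<dots> \<le> cost (h (k n)) (w (k n))"
      proof -
        have "(\<Sum>\<^sup>+x. \<Sum>\<^sup>+y. w (k n) (Some x) (Some y) * ennreal ((res_dist (h (k n)) (Some x) (Some y))\<^sup>2))
          \<le> (\<Sum>\<^sup>+x. \<Sum>\<^sup>+b. w (k n) (Some x) b * ennreal ((res_dist (h (k n)) (Some x) b)\<^sup>2))"
          by (intro usum_mono) (simp add: usum_option)
        also have "\<dots> \<le> cost (h (k n)) (w (k n))"
          unfolding cost_def by (subst (2) usum_option) simp
        finally show ?thesis .
      qed
      also note cw
      finally show "(\<Sum>\<^sup>+p. w (k n) (Some (fst p)) (Some (snd p)) * ennreal ((res_dist (h (k n)) (Some (fst p)) (Some (snd p)))\<^sup>2))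
          \<le> ennreal C" .
    qed
    then show "(\<Sum>\<^sup>+x. \<Sum>\<^sup>+y. l x y * ennreal ((dist x y)\<^sup>2)) \<le> ennreal C"
      by (subst usum_pair) simp
  qed
qed

section \<open>Configurations and couplings as families of weights\<close>

text \<open>The measure with point masses \<open>m\<close> on the \<open>\<sigma>\<close>-algebra of \<open>N\<close>; only the \<open>\<sigma>\<close>-algebra of \<open>N\<close> is used.\<close>

definition discrete :: "'b measure \<Rightarrow> ('b \<Rightarrow> ennreal) \<Rightarrow> 'b measure" where
  "discrete N m = distr (density (count_space UNIV) m) N (\<lambda>x. x)"

lemma sets_discrete [simp]: "sets (discrete N m) = sets N"
  and space_discrete [simp]: "space (discrete N m) = space N"
  by (simp_all add: discrete_def)

lemma nn_integral_discrete:
  assumes "space N = UNIV" "f \<in> borel_measurable N"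
  shows "(\<integral>\<^sup>+x. f x \<partial>discrete N m) = (\<Sum>\<^sup>+x. m x * f x)"
  using assms unfolding discrete_def
  by (subst nn_integral_distr) (auto simp: nn_integral_density)

lemma emeasure_discrete:
  assumes "space N = UNIV" "A \<in> sets N"
  shows "emeasure (discrete N m) A = (\<Sum>\<^sup>+x. m x * indicator A x)"
  using nn_integral_discrete[of N "indicator A" m] assms by simp

lemma subalgebra_borelD:
  assumes "subalgebra M borel"
  shows "space M = UNIV" "A \<in> sets borel \<Longrightarrow> A \<in> sets M"
  using assms by (auto simp: subalgebra_def)

lemma singleton_in_sets:
  fixes M :: "'a::metric_space measure"
  shows "subalgebra M borel \<Longrightarrow> {x} \<in> sets M"
  by (rule subalgebra_borelD) auto

abbreviation weight :: "'b measure \<Rightarrow> 'b \<Rightarrow> ennreal" where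
  "weight \<gamma> x \<equiv> emeasure \<gamma> {x}"

lemma configuration_sets:
  assumes "\<gamma> \<in> configurations M" "subalgebra M borel"
  shows "sets \<gamma> = sets M" "space \<gamma> = UNIV"
  using assms sets_eq_imp_space_eq[of \<gamma> M] by (auto simp: configurations_def subalgebra_borelD)

text \<open>A configuration is the sum of its point masses, and these are integers.\<close>

lemma configuration_weight:
  fixes M :: "'a::metric_space measure"
  assumes "\<gamma> \<in> configurations M" and M: "subalgebra M borel"
  shows "A \<in> sets M \<Longrightarrow> emeasure \<gamma> A = (\<Sum>\<^sup>+x. weight \<gamma> x * indicator A x)"
    and "weight \<gamma> y \<noteq> 0 \<Longrightarrow> 1 \<le> weight \<gamma> y"
proof -
  obtain N :: enat and x :: "nat \<Rightarrow> 'a" where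
    "\<And>A. A \<in> sets M \<Longrightarrow> emeasure \<gamma> A = (\<Sum>i. if enat i < N then emeasure (return M (x i)) A else 0)"
    using assms(1) unfolding configurations_def by blast
  then have em: "emeasure \<gamma> A = (\<Sum>\<^sup>+i. if enat i < N then indicator A (x i) else 0)" if "A \<in> sets M" for A
    using that by (simp add: nn_integral_count_space_nat cong: if_cong)
  {
    assume A: "A \<in> sets M"
    have "(\<Sum>\<^sup>+y. weight \<gamma> y * indicator A y)
        = (\<Sum>\<^sup>+y. \<Sum>\<^sup>+i. (if enat i < N then indicator {y} (x i) else 0) * indicator A y)"
      by (simp add: em singleton_in_sets[OF M] usum_multc)
    also have "\<dots> = (\<Sum>\<^sup>+i. \<Sum>\<^sup>+y. (if enat i < N then indicator {y} (x i) else 0) * indicator A y)"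
      by (rule usum_swap)
    also have "\<dots> = (\<Sum>\<^sup>+i. if enat i < N then indicator A (x i) else 0)"
    proof (intro nn_integral_cong)
      fix i
      show "(\<Sum>\<^sup>+y. (if enat i < N then indicator {y} (x i) else 0) * indicator A y)
        = (if enat i < N then indicator A (x i) else 0)"
        by (subst usum_single[where x = "x i"]) auto
    qed
    finally show "emeasure \<gamma> A = (\<Sum>\<^sup>+x. weight \<gamma> x * indicator A x)"
      using em[OF A] by simp
  next
    assume "weight \<gamma> y \<noteq> 0"
    have "\<exists>i. (if enat i < N then indicator {y} (x i) else 0 :: ennreal) \<noteq> 0"
    proof (rule ccontr)
      assume "\<nexists>i. (if enat i < N then indicator {y} (x i) else 0 :: ennreal) \<noteq> 0"
      then have "weight \<gamma> y = (\<Sum>\<^sup>+i::nat. 0)"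
        unfolding em[OF singleton_in_sets[OF M]] by (intro nn_integral_cong) auto
      with \<open>weight \<gamma> y \<noteq> 0\<close> show False by simp
    qed
    then obtain i where "(if enat i < N then indicator {y} (x i) else 0 :: ennreal) \<noteq> 0" by blast
    then have "1 \<le> (if enat i < N then indicator {y} (x i) else 0 :: ennreal)"
      by (auto split: if_splits split_indicator simp: indicator_def)
    also have "\<dots> \<le> weight \<gamma> y"
      unfolding em[OF singleton_in_sets[OF M]] by (rule usum_ge_point)
    finally show "1 \<le> weight \<gamma> y" .
  }
qed

lemma locally_finite_weight:
  fixes M :: "'a::metric_space measure"
  assumes g: "\<gamma> \<in> configurations M" and M: "subalgebra M borel"
  shows "locally_finite (weight \<gamma>)"
  unfolding locally_finite_def
proof (intro conjI allI impI)
  fix x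
  have "{x} \<in> bounded_ring M" by (simp add: bounded_ring_def singleton_in_sets[OF M])
  then show "weight \<gamma> x < \<top>" using g by (auto simp: configurations_def)
next
  fix B :: "'a set" assume "bounded B"
  then obtain c R where BR: "B \<subseteq> ball c R"
    by (meson bounded_subset_ballD)
  have E: "ball c R \<in> sets M" by (rule subalgebra_borelD[OF M]) auto
  then have "ball c R \<in> bounded_ring M" by (simp add: bounded_ring_def)
  then have fin: "emeasure \<gamma> (ball c R) < \<top>" using g by (auto simp: configurations_def)
  have "emeasure (count_space UNIV) {x \<in> B. weight \<gamma> x \<noteq> 0} = (\<Sum>\<^sup>+x. indicator {x \<in> B. weight \<gamma> x \<noteq> 0} x)"
    by simp
  also have "\<dots> \<le> (\<Sum>\<^sup>+x. weight \<gamma> x * indicator (ball c R) x)"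
    using BR configuration_weight(2)[OF g M] by (intro usum_mono) (auto split: split_indicator)
  also have "\<dots> < \<top>" using fin configuration_weight(1)[OF g M E] by simp
  finally show "finite {x \<in> B. weight \<gamma> x \<noteq> 0}"
    by (simp add: emeasure_count_space split: if_splits)
qed

lemma configuration_eq_discrete:
  fixes M :: "'a::metric_space measure"
  assumes g: "\<gamma> \<in> configurations M" and M: "subalgebra M borel"
  shows "\<gamma> = discrete M (weight \<gamma>)"
proof (rule measure_eqI)
  fix A assume "A \<in> sets \<gamma>"
  then have A: "A \<in> sets M" by (simp add: configuration_sets[OF g M])
  show "emeasure \<gamma> A = emeasure (discrete M (weight \<gamma>)) A"
    unfolding configuration_weight(1)[OF g M A] emeasure_discrete[OF subalgebra_borelD(1)[OF M] A]
    by (rule refl)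
qed (simp add: configuration_sets[OF g M])

lemma nn_integral_configuration:
  fixes M :: "'a::metric_space measure"
  assumes g: "\<gamma> \<in> configurations M" and M: "subalgebra M borel" and f: "f \<in> borel_measurable borel"
  shows "(\<integral>\<^sup>+x. f x \<partial>\<gamma>) = (\<Sum>\<^sup>+x. weight \<gamma> x * f x)"
proof -
  have "(\<integral>\<^sup>+x. f x \<partial>\<gamma>) = (\<integral>\<^sup>+x. f x \<partial>discrete M (weight \<gamma>))"
    by (rule arg_cong[OF configuration_eq_discrete[OF g M]])
  also have "\<dots> = (\<Sum>\<^sup>+x. weight \<gamma> x * f x)"
    by (intro nn_integral_discrete measurable_from_subalg[OF M f] subalgebra_borelD(1)[OF M])
  finally show ?thesis .
qed

lemma integrable_test_function:
  fixes M :: "'a::metric_space measure"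
  assumes g: "\<gamma> \<in> configurations M" and M: "subalgebra M borel" and f: "f \<in> vague_test_functions"
  shows "integrable \<gamma> f"
proof (rule integrableI_bounded)
  have fb: "f \<in> borel_measurable borel"
    using f by (auto simp: vague_test_functions_def intro: borel_measurable_continuous_onI)
  have "f \<in> borel_measurable M" by (rule measurable_from_subalg[OF M fb])
  then show "f \<in> borel_measurable \<gamma>"
    using measurable_cong_sets[OF configuration_sets(1)[OF g M] refl] by blast
  obtain B where "bounded B" "\<And>x. x \<notin> B \<Longrightarrow> f x = 0"
    using f by (auto simp: vague_test_functions_def)
  then have "bounded {x. ennreal (norm (f x)) \<noteq> 0}"
    by (auto elim!: bounded_subset)
  then show "(\<integral>\<^sup>+x. ennreal (norm (f x)) \<partial>\<gamma>) < \<infinity>"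
    using usum_locally_finite_less_top[OF locally_finite_weight[OF g M], of "\<lambda>x. ennreal (norm (f x))"] fb
    by (subst nn_integral_configuration[OF g M]) auto
qed

lemma integral_test_function:
  fixes M :: "'a::metric_space measure"
  assumes g: "\<gamma> \<in> configurations M" and M: "subalgebra M borel" and f: "f \<in> vague_test_functions"
    and nonneg: "\<And>x. 0 \<le> f x"
  shows "(\<Sum>\<^sup>+x. weight \<gamma> x * ennreal (f x)) = ennreal (integral\<^sup>L \<gamma> f)"
proof -
  have "f \<in> borel_measurable borel"
    using f by (auto simp: vague_test_functions_def intro: borel_measurable_continuous_onI)
  then have "(\<Sum>\<^sup>+x. weight \<gamma> x * ennreal (f x)) = (\<integral>\<^sup>+x. ennreal (f x) \<partial>\<gamma>)"
    by (subst nn_integral_configuration[OF g M]) auto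
  also have "\<dots> = ennreal (integral\<^sup>L \<gamma> f)"
    using integrable_test_function[OF g M f] nonneg by (intro nn_integral_eq_integral) auto
  finally show ?thesis .
qed

lemma borel_measurable_dist_sq:
  fixes M :: "'a::polish_space measure"
  assumes M: "subalgebra M borel"
  shows "(\<lambda>(x, y). ennreal ((dist x y)\<^sup>2)) \<in> borel_measurable (M \<Otimes>\<^sub>M M)"
proof -
  have [measurable]: "(\<lambda>x. x) \<in> borel_measurable M"
    by (rule measurable_from_subalg[OF M]) simp
  have [measurable]: "fst \<in> borel_measurable (M \<Otimes>\<^sub>M M)" "snd \<in> borel_measurable (M \<Otimes>\<^sub>M M)"
    using measurable_compose[OF measurable_fst, of "\<lambda>x. x" M borel M]
      measurable_compose[OF measurable_snd, of "\<lambda>x. x" M borel M] by simp_all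
  show ?thesis by measurable
qed

lemma usum_atoms_le_nn_integral:
  assumes sing: "\<And>p. {p} \<in> sets q" and cnt: "countable {p. emeasure q {p} \<noteq> 0}"
    and g[measurable]: "g \<in> borel_measurable q"
  shows "(\<Sum>\<^sup>+p. emeasure q {p} * g p) \<le> (\<integral>\<^sup>+p. g p \<partial>q)"
proof -
  let ?S = "{p. emeasure q {p} \<noteq> 0}"
  have [measurable]: "{p} \<in> sets q" for p by (rule sing)
  have "(\<Sum>\<^sup>+p. emeasure q {p} * g p) = (\<integral>\<^sup>+p. g p * emeasure q {p} \<partial>count_space ?S)"
    unfolding mult.commute[of "emeasure q _"]
    by (rule nn_integral_count_space_eq) auto
  also have "\<dots> = (\<integral>\<^sup>+p. (\<integral>\<^sup>+r. g p * indicator {p} r \<partial>q) \<partial>count_space ?S)"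
    by (simp add: nn_integral_cmult_indicator sing)
  also have "\<dots> = (\<integral>\<^sup>+r. (\<integral>\<^sup>+p. g p * indicator {p} r \<partial>count_space ?S) \<partial>q)"
    by (rule nn_integral_count_space_nn_integral[symmetric, OF cnt]) measurable
  also have "\<dots> \<le> (\<integral>\<^sup>+r. g r \<partial>q)"
  proof (intro nn_integral_mono)
    fix r
    have "(\<integral>\<^sup>+p. g p * indicator {p} r \<partial>count_space ?S) \<le> (\<Sum>\<^sup>+p. g p * indicator {p} r)"
      by (subst nn_integral_count_space_indicator) (auto intro!: usum_mono split: split_indicator)
    also have "\<dots> = g r"
      by (subst usum_single[where x = r]) auto
    finally show "(\<integral>\<^sup>+p. g p * indicator {p} r \<partial>count_space ?S) \<le> g r" .
  qed
  finally show ?thesis .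
qed

lemma coupling_sets:
  fixes M :: "'a::metric_space measure"
  assumes "q \<in> couplings M \<gamma> \<eta>" and M: "subalgebra M borel"
  shows "sets q = sets (M \<Otimes>\<^sub>M M)" "space q = UNIV" "{p} \<in> sets q"
    "A \<in> sets M \<Longrightarrow> emeasure \<gamma> A = emeasure q (A \<times> UNIV)"
    "A \<in> sets M \<Longrightarrow> emeasure \<eta> A = emeasure q (UNIV \<times> A)"
    "A \<in> sets M \<Longrightarrow> B \<in> sets M \<Longrightarrow> A \<times> B \<in> sets q"
proof -
  show sq: "sets q = sets (M \<Otimes>\<^sub>M M)" using assms by (simp add: couplings_def)
  show sp: "space q = UNIV"
    using sets_eq_imp_space_eq[OF sq] by (simp add: space_pair_measure subalgebra_borelD(1)[OF M])
  show "{p} \<in> sets q"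
    unfolding sq using pair_measureI[OF singleton_in_sets[OF M] singleton_in_sets[OF M], of "fst p" "snd p"] by simp
  have meas: "fst \<in> measurable q M" "snd \<in> measurable q M"
    using measurable_cong_sets[OF sq refl] by auto
  have e: "\<gamma> = distr q M fst" "\<eta> = distr q M snd" using assms by (auto simp: couplings_def)
  show "emeasure \<gamma> A = emeasure q (A \<times> UNIV)" if "A \<in> sets M"
    unfolding e(1) using meas that by (subst emeasure_distr) (auto simp: sp intro!: arg_cong[where f = "emeasure q"])
  show "emeasure \<eta> A = emeasure q (UNIV \<times> A)" if "A \<in> sets M"
    unfolding e(2) using meas that by (subst emeasure_distr) (auto simp: sp intro!: arg_cong[where f = "emeasure q"])
  show "A \<times> B \<in> sets q" if "A \<in> sets M" "B \<in> sets M"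
    unfolding sq using that by (rule pair_measureI)
qed

lemma coupling_point_le:
  fixes M :: "'a::metric_space measure"
  assumes q: "q \<in> couplings M \<gamma> \<eta>" and M: "subalgebra M borel"
  shows "emeasure q {(x, y)} \<le> weight \<gamma> x" "emeasure q {(x, y)} \<le> weight \<eta> y"
proof -
  have U: "UNIV \<in> sets M" using sets.top[of M] by (simp add: subalgebra_borelD(1)[OF M])
  note s = singleton_in_sets[OF M] and cs = coupling_sets[OF q M]
  show "emeasure q {(x, y)} \<le> weight \<gamma> x"
    unfolding cs(4)[OF s] by (rule emeasure_mono[OF _ cs(6)[OF s U]]) auto
  show "emeasure q {(x, y)} \<le> weight \<eta> y"
    unfolding cs(5)[OF s] by (rule emeasure_mono[OF _ cs(6)[OF U s]]) auto
qed

text \<open>A coupling of configurations is concentrated on a countable set of pairs of atoms.\<close>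

lemma coupling_row:
  fixes M :: "'a::metric_space measure"
  assumes q: "q \<in> couplings M \<gamma> \<eta>" and M: "subalgebra M borel" and eta: "\<eta> \<in> configurations M"
  shows "(\<Sum>\<^sup>+y. emeasure q {(x, y)}) = weight \<gamma> x"
proof -
  define S where "S = {y. weight \<eta> y \<noteq> 0}"
  have cnt: "countable S"
    unfolding S_def by (rule locally_finite_countable_support[OF locally_finite_weight[OF eta M]])
  have SM: "S \<in> sets M" by (rule sets.countable[OF singleton_in_sets[OF M] cnt])
  have U: "UNIV \<in> sets M" using sets.top[of M] by (simp add: subalgebra_borelD(1)[OF M])
  have cSM: "- S \<in> sets M" using sets.compl_sets[OF SM] by (simp add: subalgebra_borelD(1)[OF M] Compl_eq_Diff_UNIV)
  note cs = coupling_sets[OF q M]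
  have "emeasure \<eta> (- S) = 0"
    unfolding configuration_weight(1)[OF eta M cSM]
    by (subst nn_integral_cong[where v = "\<lambda>_. 0"]) (auto simp: S_def split: split_indicator)
  then have "UNIV \<times> (- S) \<in> null_sets q"
    using cs(5)[OF cSM] cs(6)[OF U cSM] by auto
  then have null: "{x} \<times> (- S) \<in> null_sets q"
    by (rule null_sets_subset) (auto intro: cs(6) singleton_in_sets[OF M] cSM)
  have "weight \<gamma> x = emeasure q ({x} \<times> S \<union> {x} \<times> (- S))"
    unfolding cs(4)[OF singleton_in_sets[OF M]] by (intro arg_cong[where f = "emeasure q"]) auto
  also have "\<dots> = emeasure q ({x} \<times> S)"
    by (rule emeasure_Un_null_set[OF cs(6)[OF singleton_in_sets[OF M] SM] null])
  also have "{x} \<times> S = (\<Union>y\<in>S. {(x, y)})" by auto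
  also have "emeasure q \<dots> = (\<integral>\<^sup>+y. emeasure q {(x, y)} \<partial>count_space S)"
    by (rule emeasure_UN_countable) (auto simp: cs(3) cnt disjoint_family_on_def)
  also have "\<dots> = (\<Sum>\<^sup>+y. emeasure q {(x, y)})"
    using coupling_point_le(2)[OF q M, of x]
    by (intro nn_integral_count_space_eq) (auto simp: S_def, metis le_zero_eq)
  finally show ?thesis by simp
qed

lemma coupling_swap:
  fixes M :: "'a::metric_space measure"
  assumes q: "q \<in> couplings M \<gamma> \<eta>" and M: "subalgebra M borel"
  defines "q' \<equiv> distr q (M \<Otimes>\<^sub>M M) (\<lambda>(x, y). (y, x))"
  shows "q' \<in> couplings M \<eta> \<gamma>" "emeasure q' {(y, x)} = emeasure q {(x, y)}"
proof -
  note cs = coupling_sets[OF q M]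
  have [measurable]: "(\<lambda>(x, y). (y, x)) \<in> measurable q (M \<Otimes>\<^sub>M M)"
    using measurable_cong_sets[OF cs(1) refl] measurable_pair_swap' by blast
  have "distr q' M fst = distr q M snd" "distr q' M snd = distr q M fst"
    unfolding q'_def by (subst distr_distr; auto simp: comp_def split_beta)+
  then show "q' \<in> couplings M \<eta> \<gamma>"
    using q by (simp add: couplings_def q'_def)
  have "{(y, x)} \<in> sets (M \<Otimes>\<^sub>M M)" using cs(1,3) by simp
  moreover have "(\<lambda>(x, y). (y, x)) -` {(y, x)} \<inter> space q = {(x, y)}" by (auto simp: cs(2))
  ultimately show "emeasure q' {(y, x)} = emeasure q {(x, y)}"
    unfolding q'_def by (subst emeasure_distr) auto
qed

text \<open>The plan is the coupling itself, with the reservoir unused. The point masses of a coupling need not be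
  integers, which is why plans have arbitrary weights.\<close>

lemma plan_of_coupling:
  fixes M :: "'a::polish_space measure"
  assumes q: "q \<in> couplings M \<gamma> \<eta>" and M: "subalgebra M borel"
    and g: "\<gamma> \<in> configurations M" and eta: "\<eta> \<in> configurations M" and h: "cutoff h"
  shows "\<exists>w. plan (weight \<gamma>) (weight \<eta>) w \<and> cost h w \<le> (\<integral>\<^sup>+(x, y). ennreal ((dist x y)\<^sup>2) \<partial>q)"
proof -
  note cs = coupling_sets[OF q M]
  have row: "(\<Sum>\<^sup>+y. emeasure q {(x, y)}) = weight \<gamma> x" for x
    by (rule coupling_row[OF q M eta])
  have col: "(\<Sum>\<^sup>+x. emeasure q {(x, y)}) = weight \<eta> y" for y
    using coupling_row[OF coupling_swap(1)[OF q M] M g, of y] by (simp add: coupling_swap(2)[OF q M])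
  have lt: "weight \<gamma> x \<noteq> \<top>" "weight \<eta> x \<noteq> \<top>" for x
    using locally_finite_less_top[OF locally_finite_weight[OF g M]]
      locally_finite_less_top[OF locally_finite_weight[OF eta M]] by (auto simp: less_top)
  obtain w where w: "plan (weight \<gamma>) (weight \<eta>) w"
    and c: "cost h w \<le> (\<Sum>\<^sup>+x. \<Sum>\<^sup>+y. emeasure q {(x, y)} * ennreal ((dist x y)\<^sup>2))"
    using plan_of_partial[of "\<lambda>x y. emeasure q {(x, y)}" "weight \<gamma>" "weight \<eta>" h] h
    by (auto simp: row col lt)
  have "countable {p. emeasure q {p} \<noteq> 0}"
  proof (rule countable_subset)
    show "{p. emeasure q {p} \<noteq> 0} \<subseteq> {x. weight \<gamma> x \<noteq> 0} \<times> {y. weight \<eta> y \<noteq> 0}"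
    proof
      fix p assume "p \<in> {p. emeasure q {p} \<noteq> 0}"
      then show "p \<in> {x. weight \<gamma> x \<noteq> 0} \<times> {y. weight \<eta> y \<noteq> 0}"
        using coupling_point_le[OF q M, of "fst p" "snd p"] by (cases p) auto
    qed
    show "countable ({x. weight \<gamma> x \<noteq> 0} \<times> {y. weight \<eta> y \<noteq> 0})"
      by (intro countable_SIGMA locally_finite_countable_support locally_finite_weight[OF _ M] g eta)
  qed
  then have "(\<Sum>\<^sup>+p. emeasure q {p} * (\<lambda>(x, y). ennreal ((dist x y)\<^sup>2)) p) \<le> (\<integral>\<^sup>+(x, y). ennreal ((dist x y)\<^sup>2) \<partial>q)"
    using borel_measurable_dist_sq[OF M] measurable_cong_sets[OF cs(1) refl]
    by (intro usum_atoms_le_nn_integral cs(3)) auto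
  then have "(\<Sum>\<^sup>+x. \<Sum>\<^sup>+y. emeasure q {(x, y)} * ennreal ((dist x y)\<^sup>2)) \<le> (\<integral>\<^sup>+(x, y). ennreal ((dist x y)\<^sup>2) \<partial>q)"
    by (subst usum_pair) (simp add: split_beta)
  then show ?thesis using w c order_trans by blast
qed

lemma coupling_of_weights:
  fixes M :: "'a::polish_space measure"
  assumes M: "subalgebra M borel" and g: "\<gamma> \<in> configurations M" and eta: "\<eta> \<in> configurations M"
    and row: "\<And>x. (\<Sum>\<^sup>+y. l x y) = weight \<gamma> x" and col: "\<And>y. (\<Sum>\<^sup>+x. l x y) = weight \<eta> y"
  shows "\<exists>q\<in>couplings M \<gamma> \<eta>. (\<integral>\<^sup>+(x, y). ennreal ((dist x y)\<^sup>2) \<partial>q) = (\<Sum>\<^sup>+x. \<Sum>\<^sup>+y. l x y * ennreal ((dist x y)\<^sup>2))"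
proof
  let ?q = "discrete (M \<Otimes>\<^sub>M M) (\<lambda>p. l (fst p) (snd p))"
  note sM = subalgebra_borelD(1)[OF M]
  have sp: "space (M \<Otimes>\<^sub>M M) = UNIV" by (simp add: space_pair_measure sM)
  have meas: "fst \<in> measurable ?q M" "snd \<in> measurable ?q M"
    using measurable_cong_sets[OF sets_discrete refl] by auto
  have "distr ?q M fst = \<gamma>"
  proof (rule measure_eqI)
    fix A assume "A \<in> sets (distr ?q M fst)"
    then have A: "A \<in> sets M" by simp
    have "emeasure (distr ?q M fst) A = emeasure ?q (fst -` A)"
      using meas A by (subst emeasure_distr) (simp_all add: sp)
    also have "\<dots> = (\<Sum>\<^sup>+p. l (fst p) (snd p) * indicator (fst -` A) p)"
      using measurable_sets[OF meas(1) A] by (intro emeasure_discrete) (simp_all add: sp)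
    also have "\<dots> = (\<Sum>\<^sup>+x. \<Sum>\<^sup>+y. l x y * indicator A x)"
      by (subst usum_pair) (simp add: indicator_def)
    also have "\<dots> = emeasure \<gamma> A"
      by (simp add: usum_multc row configuration_weight(1)[OF g M A])
    finally show "emeasure (distr ?q M fst) A = emeasure \<gamma> A" .
  qed (simp add: configuration_sets[OF g M])
  moreover have "distr ?q M snd = \<eta>"
  proof (rule measure_eqI)
    fix A assume "A \<in> sets (distr ?q M snd)"
    then have A: "A \<in> sets M" by simp
    have "emeasure (distr ?q M snd) A = emeasure ?q (snd -` A)"
      using meas A by (subst emeasure_distr) (simp_all add: sp)
    also have "\<dots> = (\<Sum>\<^sup>+p. l (fst p) (snd p) * indicator (snd -` A) p)"
      using measurable_sets[OF meas(2) A] by (intro emeasure_discrete) (simp_all add: sp)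
    also have "\<dots> = (\<Sum>\<^sup>+x. \<Sum>\<^sup>+y. l x y * indicator A y)"
      by (subst usum_pair) (simp add: indicator_def)
    also have "\<dots> = (\<Sum>\<^sup>+y. \<Sum>\<^sup>+x. l x y * indicator A y)" by (rule usum_swap)
    also have "\<dots> = emeasure \<eta> A"
      by (simp add: usum_multc col configuration_weight(1)[OF eta M A])
    finally show "emeasure (distr ?q M snd) A = emeasure \<eta> A" .
  qed (simp add: configuration_sets[OF eta M])
  ultimately show "?q \<in> couplings M \<gamma> \<eta>" by (simp add: couplings_def)
  show "(\<integral>\<^sup>+(x, y). ennreal ((dist x y)\<^sup>2) \<partial>?q) = (\<Sum>\<^sup>+x. \<Sum>\<^sup>+y. l x y * ennreal ((dist x y)\<^sup>2))"
    using borel_measurable_dist_sq[OF M] by (subst nn_integral_discrete) (auto simp: sp usum_pair split_beta)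
qed

section \<open>A criterion for extended metric-topological spaces\<close>

text \<open>Continuity of a pseudo-distance at the diagonal, which implies joint continuity.\<close>

definition small_balls :: "'y topology \<Rightarrow> 'y set \<Rightarrow> ('y \<Rightarrow> 'y \<Rightarrow> real) \<Rightarrow> bool" where
  "small_balls T Y \<sigma> \<longleftrightarrow> (\<forall>x\<in>Y. \<forall>r>0. \<exists>U. openin T U \<and> x \<in> U \<and> U \<subseteq> {y \<in> Y. \<sigma> x y < r})"

lemma pseudo_distance_onD:
  assumes "pseudo_distance_on Y \<sigma>" "x \<in> Y" "y \<in> Y"
  shows "0 \<le> \<sigma> x y" "\<sigma> x y = \<sigma> y x" "\<sigma> x x = 0" "z \<in> Y \<Longrightarrow> \<sigma> x z \<le> \<sigma> x y + \<sigma> y z"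
  using assms unfolding pseudo_distance_on_def by blast+

lemma openin_pseudo_ball:
  assumes pd: "pseudo_distance_on Y \<sigma>" and sb: "small_balls T Y \<sigma>" and x: "x \<in> Y"
  shows "openin T {y \<in> Y. \<sigma> x y < r}"
proof (subst openin_subopen, intro ballI)
  fix y assume "y \<in> {y \<in> Y. \<sigma> x y < r}"
  then have y: "y \<in> Y" "0 < r - \<sigma> x y" by auto
  then obtain U where U: "openin T U" "y \<in> U" "U \<subseteq> {z \<in> Y. \<sigma> y z < r - \<sigma> x y}"
    using sb unfolding small_balls_def by blast
  moreover have "{z \<in> Y. \<sigma> y z < r - \<sigma> x y} \<subseteq> {y \<in> Y. \<sigma> x y < r}"
    using pseudo_distance_onD(4)[OF pd x y(1)] by fastforce
  ultimately show "\<exists>U. openin T U \<and> y \<in> U \<and> U \<subseteq> {y \<in> Y. \<sigma> x y < r}" by blast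
qed

lemma continuous_map_pseudo_distance:
  assumes pd: "pseudo_distance_on Y \<sigma>" and sb: "small_balls T Y \<sigma>" and top: "topspace T = Y"
  shows "continuous_map (prod_topology T T) euclideanreal (\<lambda>(x, y). \<sigma> x y)"
  unfolding continuous_map_def
proof (intro conjI allI impI)
  fix V :: "real set" assume "openin euclideanreal V"
  then have V: "open V" by simp
  show "openin (prod_topology T T) {p \<in> topspace (prod_topology T T). (case p of (x, y) \<Rightarrow> \<sigma> x y) \<in> V}"
  proof (subst openin_subopen, intro ballI)
    fix p assume p: "p \<in> {p \<in> topspace (prod_topology T T). (case p of (x, y) \<Rightarrow> \<sigma> x y) \<in> V}"
    obtain x y where xy: "p = (x, y)" by (cases p)
    with p have x: "x \<in> Y" and y: "y \<in> Y" and "\<sigma> x y \<in> V" by (auto simp: top)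
    then obtain e where e: "0 < e" "ball (\<sigma> x y) e \<subseteq> V"
      using V by (meson open_contains_ball)
    let ?W = "{x' \<in> Y. \<sigma> x x' < e / 2} \<times> {y' \<in> Y. \<sigma> y y' < e / 2}"
    have "openin (prod_topology T T) ?W"
      unfolding openin_prod_Times_iff
      using openin_pseudo_ball[OF pd sb x] openin_pseudo_ball[OF pd sb y] by blast
    moreover have "p \<in> ?W"
      using pseudo_distance_onD(3)[OF pd x x] pseudo_distance_onD(3)[OF pd y y] by (simp add: xy x y e)
    moreover have "?W \<subseteq> {p \<in> topspace (prod_topology T T). (case p of (x, y) \<Rightarrow> \<sigma> x y) \<in> V}"
    proof (clarsimp simp: top)
      fix x' y' assume x': "x' \<in> Y" "\<sigma> x x' * 2 < e" and y': "y' \<in> Y" "\<sigma> y y' * 2 < e"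
      have "\<sigma> x y \<le> \<sigma> x x' + \<sigma> x' y" "\<sigma> x' y \<le> \<sigma> x' y' + \<sigma> y' y"
        "\<sigma> x' y' \<le> \<sigma> x' x + \<sigma> x y'" "\<sigma> x y' \<le> \<sigma> x y + \<sigma> y y'"
        "\<sigma> x' x = \<sigma> x x'" "\<sigma> y' y = \<sigma> y y'"
        using pseudo_distance_onD[OF pd] x y x'(1) y'(1) by blast+
      then have "\<sigma> x' y' \<in> ball (\<sigma> x y) e"
        using x' y' by (simp add: dist_real_def)
      then show "\<sigma> x' y' \<in> V" using e by blast
    qed
    ultimately show "\<exists>W. openin (prod_topology T T) W \<and> p \<in> W \<and>
        W \<subseteq> {p \<in> topspace (prod_topology T T). (case p of (x, y) \<Rightarrow> \<sigma> x y) \<in> V}" by blast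
  qed
qed simp

lemma pseudo_distance_on_max:
  assumes "pseudo_distance_on Y \<sigma>" "pseudo_distance_on Y \<tau>"
  shows "pseudo_distance_on Y (\<lambda>x y. max (\<sigma> x y) (\<tau> x y))"
  unfolding pseudo_distance_on_def
proof (intro conjI ballI)
  fix x y z assume xyz: "x \<in> Y" "y \<in> Y" "z \<in> Y"
  show "max (\<sigma> x z) (\<tau> x z) \<le> max (\<sigma> x y) (\<tau> x y) + max (\<sigma> y z) (\<tau> y z)"
    using pseudo_distance_onD(4)[OF assms(1) xyz] pseudo_distance_onD(4)[OF assms(2) xyz] by linarith
qed (use pseudo_distance_onD[OF assms(1)] pseudo_distance_onD[OF assms(2)] in \<open>auto simp: le_max_iff_disj\<close>)

text \<open>The witness is the family of all continuous pseudo-distances below \<open>d\<close>.\<close>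

lemma extended_metric_topological_spaceI:
  fixes \<rho> :: "nat \<Rightarrow> 'y \<Rightarrow> 'y \<Rightarrow> real"
  assumes T: "T = topology_generated_by S" and top: "topspace T = Y"
    and pd: "\<And>n. pseudo_distance_on Y (\<rho> n)" and sb: "\<And>n. small_balls T Y (\<rho> n)"
    and gen: "\<And>V x. V \<in> S \<Longrightarrow> x \<in> V \<Longrightarrow> \<exists>n. \<exists>r>0. {y \<in> Y. \<rho> n x y < r} \<subseteq> V"
    and sep: "\<And>x y. x \<in> Y \<Longrightarrow> y \<in> Y \<Longrightarrow> x \<noteq> y \<Longrightarrow> \<exists>n. \<rho> n x y \<noteq> 0"
    and sup: "\<And>x y. x \<in> Y \<Longrightarrow> y \<in> Y \<Longrightarrow> d x y = (SUP n. ennreal (\<rho> n x y))"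
  shows "extended_metric_topological_space Y T d"
proof -
  define UP where "UP = {\<sigma>. pseudo_distance_on Y \<sigma> \<and> small_balls T Y \<sigma> \<and> (\<forall>x\<in>Y. \<forall>y\<in>Y. ennreal (\<sigma> x y) \<le> d x y)}"
  have le: "ennreal (\<rho> n x y) \<le> d x y" if "x \<in> Y" "y \<in> Y" for n x y
    unfolding sup[OF that] by (rule SUP_upper) simp
  have rho_UP: "\<rho> n \<in> UP" for n using pd sb le by (simp add: UP_def)
  have "uniformity_on Y UP"
    unfolding uniformity_on_def
  proof (intro conjI ballI allI impI)
    show "pseudo_distance_on Y \<sigma>" if "\<sigma> \<in> UP" for \<sigma> using that by (simp add: UP_def)
  next
    fix \<sigma> \<tau> assume s: "\<sigma> \<in> UP" and t: "\<tau> \<in> UP"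
    have "small_balls T Y (\<lambda>x y. max (\<sigma> x y) (\<tau> x y))"
      unfolding small_balls_def
    proof (intro ballI allI impI)
      fix x and r :: real assume x: "x \<in> Y" "0 < r"
      obtain U V where "openin T U" "x \<in> U" "U \<subseteq> {y \<in> Y. \<sigma> x y < r}"
          "openin T V" "x \<in> V" "V \<subseteq> {y \<in> Y. \<tau> x y < r}"
        using s t x unfolding UP_def small_balls_def by blast
      then show "\<exists>U. openin T U \<and> x \<in> U \<and> U \<subseteq> {y \<in> Y. max (\<sigma> x y) (\<tau> x y) < r}"
        by (intro exI[of _ "U \<inter> V"]) auto
    qed
    then show "(\<lambda>x y. max (\<sigma> x y) (\<tau> x y)) \<in> UP"
      using s t pseudo_distance_on_max[of Y \<sigma> \<tau>] by (auto simp: UP_def max_def)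
  next
    fix \<sigma> \<tau> assume t: "\<tau> \<in> UP" and s: "pseudo_distance_on Y \<sigma> \<and> (\<forall>x\<in>Y. \<forall>y\<in>Y. \<sigma> x y \<le> \<tau> x y)"
    have "small_balls T Y \<sigma>"
      unfolding small_balls_def
    proof (intro ballI allI impI)
      fix x and r :: real assume x: "x \<in> Y" "0 < r"
      obtain U where "openin T U" "x \<in> U" "U \<subseteq> {y \<in> Y. \<tau> x y < r}"
        using t x unfolding UP_def small_balls_def by blast
      moreover have "{y \<in> Y. \<tau> x y < r} \<subseteq> {y \<in> Y. \<sigma> x y < r}"
        using s x by fastforce
      ultimately show "\<exists>U. openin T U \<and> x \<in> U \<and> U \<subseteq> {y \<in> Y. \<sigma> x y < r}" by blast
    qed
    moreover have "ennreal (\<sigma> x y) \<le> d x y" if "x \<in> Y" "y \<in> Y" for x y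
      using s t that order_trans[OF ennreal_leI, of "\<sigma> x y" "\<tau> x y" "d x y"] by (simp add: UP_def)
    ultimately show "\<sigma> \<in> UP" using s by (simp add: UP_def)
  qed
  moreover have "separates_points_on Y UP"
    unfolding separates_points_on_def using sep rho_UP by blast
  moreover have "\<forall>\<sigma>\<in>UP. continuous_map (prod_topology T T) euclideanreal (\<lambda>(x, y). \<sigma> x y)"
    using continuous_map_pseudo_distance[OF _ _ top] by (auto simp: UP_def)
  moreover have "uniformity_topology Y UP = T"
  proof (rule topology_eq[THEN iffD2], intro allI iffI)
    fix A assume "openin (uniformity_topology Y UP) A"
    then show "openin T A"
      unfolding uniformity_topology_def openin_topology_generated_by_iff
      by (rule generate_topology_on_coarsest[rotated -1])
        (auto intro: openin_pseudo_ball simp: UP_def)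
  next
    fix A assume "openin T A"
    then have "generate_topology_on S A" by (simp add: T openin_topology_generated_by_iff)
    then show "openin (uniformity_topology Y UP) A"
    proof (rule generate_topology_on_coarsest[rotated -1])
      fix V assume V: "V \<in> S"
      then have "V \<subseteq> Y" using top T topology_generated_by_Basis openin_subset by metis
      show "openin (uniformity_topology Y UP) V"
      proof (subst openin_subopen, intro ballI)
        fix x assume x: "x \<in> V"
        then obtain n r where r: "0 < r" "{y \<in> Y. \<rho> n x y < r} \<subseteq> V" using gen V by blast
        have "openin (uniformity_topology Y UP) {y \<in> Y. \<rho> n x y < r}"
          unfolding uniformity_topology_def using r x \<open>V \<subseteq> Y\<close> rho_UP
          by (intro topology_generated_by_Basis) blast
        moreover have "x \<in> {y \<in> Y. \<rho> n x y < r}"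
          using pseudo_distance_onD(3)[OF pd, of x] x \<open>V \<subseteq> Y\<close> r by auto
        ultimately show "\<exists>W. openin (uniformity_topology Y UP) W \<and> x \<in> W \<and> W \<subseteq> V"
          using r by blast
      qed
    qed simp
  qed
  moreover have "d x y = (SUP \<sigma>\<in>UP. ennreal (\<sigma> x y))" if "x \<in> Y" "y \<in> Y" for x y
  proof (rule antisym)
    show "d x y \<le> (SUP \<sigma>\<in>UP. ennreal (\<sigma> x y))"
      unfolding sup[OF that]
      by (intro SUP_least) (rule SUP_upper[OF rho_UP, of "\<lambda>\<sigma>. ennreal (\<sigma> x y)"])
    show "(SUP \<sigma>\<in>UP. ennreal (\<sigma> x y)) \<le> d x y"
      using that by (intro SUP_least) (simp add: UP_def)
  qed
  moreover have "extended_distance_on Y d"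
    unfolding extended_distance_on_def
  proof (intro conjI ballI)
    fix x y assume xy: "x \<in> Y" "y \<in> Y"
    show "d x y = d y x"
      using pseudo_distance_onD(2)[OF pd xy] by (simp add: sup xy)
    show "d x y = 0 \<longleftrightarrow> x = y"
    proof
      assume 0: "d x y = 0"
      have "\<rho> n x y = 0" for n
        using le[OF xy, of n] pseudo_distance_onD(1)[OF pd xy, of n] by (simp add: 0)
      then show "x = y" using sep[OF xy] by blast
    next
      assume "x = y"
      then show "d x y = 0" using pseudo_distance_onD(3)[OF pd xy] by (simp add: sup xy)
    qed
  next
    fix x y z assume xyz: "x \<in> Y" "y \<in> Y" "z \<in> Y"
    have "ennreal (\<rho> n x z) \<le> d x y + d y z" for n
    proof -
      have "ennreal (\<rho> n x z) \<le> ennreal (\<rho> n x y + \<rho> n y z)"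
        using pseudo_distance_onD(4)[OF pd xyz] by (rule ennreal_leI)
      also have "\<dots> = ennreal (\<rho> n x y) + ennreal (\<rho> n y z)"
        using pseudo_distance_onD(1)[OF pd] xyz by (intro ennreal_plus)
      also have "\<dots> \<le> d x y + d y z" using le xyz by (intro add_mono)
      finally show ?thesis .
    qed
    then show "d x z \<le> d x y + d y z"
      unfolding sup[OF xyz(1,3)] by (rule SUP_least)
  qed
  moreover have "Hausdorff_space T"
    unfolding Hausdorff_space_def top
  proof (intro allI impI, elim conjE)
    fix x y assume xy: "x \<in> Y" "y \<in> Y" "x \<noteq> y"
    then obtain n where n: "\<rho> n x y \<noteq> 0" using sep by blast
    define r where "r = \<rho> n x y / 2"
    have r: "0 < r" using n pseudo_distance_onD(1)[OF pd xy(1,2), of n] by (simp add: r_def)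
    let ?U = "{z \<in> Y. \<rho> n x z < r}" and ?V = "{z \<in> Y. \<rho> n y z < r}"
    have "openin T ?U" "openin T ?V" by (intro openin_pseudo_ball[OF pd sb] xy)+
    moreover have "x \<in> ?U" "y \<in> ?V"
      using pseudo_distance_onD(3)[OF pd xy(1,1)] pseudo_distance_onD(3)[OF pd xy(2,2)] xy r by auto
    moreover have "disjnt ?U ?V"
    proof -
      have False if "z \<in> Y" "\<rho> n x z < r" "\<rho> n y z < r" for z
        using pseudo_distance_onD(4)[OF pd xy(1) that(1) xy(2), of n]
          pseudo_distance_onD(2)[OF pd xy(2) that(1), of n] that by (simp add: r_def)
      then show ?thesis by (auto simp: disjnt_iff)
    qed
    ultimately show "\<exists>U V. openin T U \<and> openin T V \<and> x \<in> U \<and> y \<in> V \<and> disjnt U V" by blast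
  qed
  ultimately show ?thesis
    unfolding extended_metric_topological_space_def using top by blast
qed

section \<open>The configuration space\<close>

text \<open>The cut-off at radius \<open>n\<close>. The centre \<open>undefined\<close> is an arbitrary fixed point.\<close>

definition cone :: "nat \<Rightarrow> 'a::metric_space \<Rightarrow> real" where
  "cone n x = max 0 (real n - dist undefined x)"

lemma cone_le: "cone n x \<le> real n"
  by (simp add: cone_def)

lemma cutoff_cone: "cutoff (cone n)"
  unfolding cutoff_def
proof (intro conjI allI)
  show "0 \<le> cone n x" for x by (simp add: cone_def)
  show "cone n x \<le> cone n y + dist x y" for x y
    using dist_triangle[of undefined y x] by (simp add: cone_def dist_commute)
  have "{x. cone n x \<noteq> 0} \<subseteq> ball undefined (real n)"
    by (auto simp: cone_def)
  then show "bounded {x. cone n x \<noteq> 0}" by (rule bounded_subset[OF bounded_ball])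
qed

lemma filterlim_cone: "filterlim (\<lambda>n. cone n x) at_top sequentially"
proof -
  have "filterlim (\<lambda>n. - dist undefined x + real n) at_top sequentially"
    by (rule filterlim_tendsto_add_at_top[OF tendsto_const filterlim_real_sequentially])
  then show ?thesis
    by (rule filterlim_at_top_mono) (simp add: cone_def)
qed

text \<open>The partial transport pseudo-distance at radius \<open>n\<close> between the point masses of two measures.\<close>

definition level_dist :: "nat \<Rightarrow> 'a::metric_space measure \<Rightarrow> 'a measure \<Rightarrow> real" where
  "level_dist n \<gamma> \<eta> = partial_transport (cone n) (weight \<gamma>) (weight \<eta>)"

lemma pseudo_distance_level_dist:
  fixes M :: "'a::metric_space measure"
  assumes M: "subalgebra M borel"
  shows "pseudo_distance_on (configurations M) (level_dist n)"
  unfolding pseudo_distance_on_def level_dist_def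
  by (intro conjI ballI partial_transport_nonneg partial_transport_commute partial_transport_self
      partial_transport_triangle cutoff_cone locally_finite_weight[OF _ M])

lemma level_dist_le_transport_dist:
  fixes M :: "'a::polish_space measure"
  assumes M: "subalgebra M borel" and g: "\<gamma> \<in> configurations M" and eta: "\<eta> \<in> configurations M"
  shows "ennreal (level_dist n \<gamma> \<eta>) \<le> transport_dist M \<gamma> \<eta>"
  unfolding transport_dist_def
proof (rule INF_greatest)
  fix q assume q: "q \<in> couplings M \<gamma> \<eta>"
  let ?c = "\<integral>\<^sup>+(x, y). ennreal ((dist x y)\<^sup>2) \<partial>q"
  show "ennreal (level_dist n \<gamma> \<eta>) \<le> ennreal_sqrt ?c"
  proof (cases "?c")
    case (real k)
    obtain w where w: "plan (weight \<gamma>) (weight \<eta>) w" "cost (cone n) w \<le> ennreal k"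
      using plan_of_coupling[OF q M g eta cutoff_cone, of n] real by auto
    have "level_dist n \<gamma> \<eta> \<le> sqrt k + e" if e: "0 < e" for e
      unfolding level_dist_def
    proof (rule partial_transport_leI[OF _ w(1)])
      show "0 < sqrt k + e" using real e by (simp add: add_nonneg_pos)
      have "k \<le> (sqrt k + e)\<^sup>2"
        using real e power_mono[of "sqrt k" "sqrt k + e" 2] by simp
      then show "cost (cone n) w \<le> ennreal ((sqrt k + e)\<^sup>2)"
        using w(2) by (meson ennreal_leI order_trans)
    qed
    then have "level_dist n \<gamma> \<eta> \<le> sqrt k" by (rule field_le_epsilon)
    then show ?thesis using real by (simp add: ennreal_sqrt_def ennreal_leI)
  qed (simp add: ennreal_sqrt_def)
qed

text \<open>The level distances recover the transport distance, including the value \<open>\<infinity>\<close>.\<close>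

lemma transport_dist_eq_SUP:
  fixes M :: "'a::polish_space measure"
  assumes M: "subalgebra M borel" and g: "\<gamma> \<in> configurations M" and eta: "\<eta> \<in> configurations M"
  shows "transport_dist M \<gamma> \<eta> = (SUP n. ennreal (level_dist n \<gamma> \<eta>))"
proof (rule antisym)
  show "(SUP n. ennreal (level_dist n \<gamma> \<eta>)) \<le> transport_dist M \<gamma> \<eta>"
    by (intro SUP_least level_dist_le_transport_dist[OF M g eta])
  let ?s = "SUP n. ennreal (level_dist n \<gamma> \<eta>)"
  note lf = locally_finite_weight[OF g M] locally_finite_weight[OF eta M]
  show "transport_dist M \<gamma> \<eta> \<le> ?s"
  proof (cases ?s)
    case (real t)
    have le: "level_dist n \<gamma> \<eta> \<le> t" for n
    proof -
      have "ennreal (level_dist n \<gamma> \<eta>) \<le> ?s" by (rule SUP_upper) simp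
      then show ?thesis using real by (simp add: ennreal_le_iff)
    qed
    show ?thesis
    proof (rule ennreal_le_epsilon)
      fix e :: real assume e: "0 < e"
      have "\<exists>w. plan (weight \<gamma>) (weight \<eta>) w \<and> cost (cone n) w \<le> ennreal ((t + e)\<^sup>2)" for n
        using partial_transport_lessD[OF cutoff_cone lf, of n "t + e"] le[of n] e
        by (auto simp: level_dist_def)
      then obtain l where row: "\<And>x. (\<Sum>\<^sup>+y. l x y) = weight \<gamma> x" and col: "\<And>y. (\<Sum>\<^sup>+x. l x y) = weight \<eta> y"
        and c: "(\<Sum>\<^sup>+x. \<Sum>\<^sup>+y. l x y * ennreal ((dist x y)\<^sup>2)) \<le> ennreal ((t + e)\<^sup>2)"
        using plan_limit[OF lf cutoff_cone filterlim_cone, of "(t + e)\<^sup>2"] by auto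
      obtain q where q: "q \<in> couplings M \<gamma> \<eta>"
        and "(\<integral>\<^sup>+(x, y). ennreal ((dist x y)\<^sup>2) \<partial>q) = (\<Sum>\<^sup>+x. \<Sum>\<^sup>+y. l x y * ennreal ((dist x y)\<^sup>2))"
        using coupling_of_weights[OF M g eta row col] by (elim bexE)
      then have cq: "(\<integral>\<^sup>+(x, y). ennreal ((dist x y)\<^sup>2) \<partial>q) \<le> ennreal ((t + e)\<^sup>2)"
        using c by simp
      have sqrt_le: "ennreal_sqrt c \<le> ennreal (t + e)" if "c \<le> ennreal ((t + e)\<^sup>2)" for c
      proof -
        obtain k where k: "0 \<le> k" "c = ennreal k" using \<open>c \<le> ennreal ((t + e)\<^sup>2)\<close> by (cases c) (auto simp: top_unique)
        have "sqrt k \<le> t + e"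
          using that k real e by (intro real_le_lsqrt) (auto simp: ennreal_le_iff)
        then show ?thesis using k by (simp add: ennreal_sqrt_def ennreal_leI)
      qed
      have "transport_dist M \<gamma> \<eta> \<le> ennreal (t + e)"
        unfolding transport_dist_def by (rule INF_lower2[OF q]) (rule sqrt_le[OF cq])
      then show "transport_dist M \<gamma> \<eta> \<le> ?s + ennreal e"
        using real e by simp
    qed
  next
    case top
    show ?thesis unfolding top by (rule top_greatest)
  qed
qed

lemma topspace_vague_topology: "topspace (vague_topology M) = configurations M"
proof -
  have "(\<lambda>x. 0) \<in> vague_test_functions"
    by (auto simp: vague_test_functions_def intro: exI[of _ "{}"])
  then have "{\<gamma> \<in> configurations M. integral\<^sup>L \<gamma> (\<lambda>x. 0) \<in> (UNIV :: real set)}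
      \<in> {{\<gamma> \<in> configurations M. integral\<^sup>L \<gamma> f \<in> U} | f U. f \<in> vague_test_functions \<and> open U}"
    by blast
  then show ?thesis
    unfolding vague_topology_def topology_generated_by_topspace by (intro antisym) auto
qed

lemma continuous_map_integral:
  assumes "f \<in> vague_test_functions"
  shows "continuous_map (vague_topology M) euclideanreal (\<lambda>\<gamma>. integral\<^sup>L \<gamma> f)"
  unfolding continuous_map_def topspace_vague_topology
  using assms by (auto simp: vague_topology_def intro!: topology_generated_by_Basis)

lemma bump_test_function:
  assumes "0 < s"
  shows "bump s x \<in> vague_test_functions"
  unfolding vague_test_functions_def
proof (intro CollectI conjI exI[of _ "ball x s"] allI impI)
  show "continuous_on UNIV (bump s x)"
    unfolding bump_def using assms by (intro continuous_intros) auto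
  show "bounded (range (bump s x))"
    using bump_nonneg[of s x] bump_le_1[OF assms, of x] by (intro boundedI[of _ 1]) auto
  show "bump s x y = 0" if "y \<notin> ball x s" for y
    using that assms by (intro bump_eq_0) auto
qed simp

lemma small_balls_level_dist:
  fixes M :: "'a::polish_space measure"
  assumes M: "subalgebra M borel"
  shows "small_balls (vague_topology M) (configurations M) (level_dist n)"
  unfolding small_balls_def
proof (intro ballI allI impI)
  fix \<gamma> and r :: real assume g: "\<gamma> \<in> configurations M" and r: "0 < r"
  note lf = locally_finite_weight[OF g M]
  define h :: "'a \<Rightarrow> real" where "h = cone n"
  have h: "cutoff h" unfolding h_def by (rule cutoff_cone)
  define F where "F = {x. weight \<gamma> x \<noteq> 0 \<and> h x \<noteq> 0}"
  have fin: "finite F" unfolding F_def by (rule locally_finite_cutoff_support[OF lf h])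
  define mu where "mu = (\<lambda>x. enn2real (weight \<gamma> x))"
  have mu: "weight \<gamma> x = ennreal (mu x)" "0 \<le> mu x" for x
    using locally_finite_less_top[OF lf, of x] by (simp_all add: mu_def)
  define N where "N = (\<Sum>x\<in>F. mu x)"
  have "\<forall>\<^sub>F s in at_right 0. x \<noteq> x' \<longrightarrow> 2 * s \<le> dist x x'" for x x' :: 'a
    by (cases "x = x'") (auto simp: eventually_at_right_field intro!: exI[of _ "dist x x' / 2"])
  then have "\<forall>\<^sub>F s in at_right 0. \<forall>x\<in>F. \<forall>x'\<in>F. x \<noteq> x' \<longrightarrow> 2 * s \<le> dist x x'"
    by (intro eventually_ball_finite fin ballI)
  moreover have "\<forall>\<^sub>F s in at_right 0. \<forall>x\<in>F. s \<le> h x"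
  proof (intro eventually_ball_finite fin ballI)
    fix x assume "x \<in> F"
    then have "0 < h x" using cutoff_nonneg[OF h, of x] by (simp add: F_def)
    then show "\<forall>\<^sub>F s in at_right 0. s \<le> h x"
      by (auto simp: eventually_at_right_field intro!: exI[of _ "h x"])
  qed
  moreover have "((\<lambda>s. s\<^sup>2 * N) \<longlongrightarrow> 0\<^sup>2 * N) (at_right 0)"
    by (intro tendsto_intros)
  then have "\<forall>\<^sub>F s in at_right 0. s\<^sup>2 * N < (r / 2)\<^sup>2"
    using r by (intro order_tendstoD(2)) auto
  moreover have "\<forall>\<^sub>F s::real in at_right 0. 0 < s"
    by (auto simp: eventually_at_right_field intro: exI[of _ 1])
  ultimately have "\<forall>\<^sub>F s in at_right 0. (\<forall>x\<in>F. \<forall>x'\<in>F. x \<noteq> x' \<longrightarrow> 2 * s \<le> dist x x') \<and>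
      (\<forall>x\<in>F. s \<le> h x) \<and> s\<^sup>2 * N < (r / 2)\<^sup>2 \<and> 0 < s"
    by eventually_elim auto
  then have "\<exists>s. (\<forall>x\<in>F. \<forall>x'\<in>F. x \<noteq> x' \<longrightarrow> 2 * s \<le> dist x x') \<and>
      (\<forall>x\<in>F. s \<le> h x) \<and> s\<^sup>2 * N < (r / 2)\<^sup>2 \<and> 0 < s"
    by (rule eventually_happens'[OF trivial_limit_at_right_real])
  then obtain s where disj': "\<forall>x\<in>F. \<forall>x'\<in>F. x \<noteq> x' \<longrightarrow> 2 * s \<le> dist x x'"
    and sh': "\<forall>x\<in>F. s \<le> h x" and sN: "s\<^sup>2 * N < (r / 2)\<^sup>2" and s: "0 < s"
    by (elim exE conjE) (rule that)
  have disj: "2 * s \<le> dist x x'" if "x \<in> F" "x' \<in> F" "x \<noteq> x'" for x x'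
    using disj' that by blast
  have sh: "s \<le> h x" if "x \<in> F" for x
    using sh' that by blast
  \<comment> \<open>The integral of \<open>\<psi>\<close> controls the mass that is above the reservoir but away from \<open>F\<close>.\<close>
  define \<psi> where "\<psi> = (\<lambda>y. (1 - (\<Sum>x\<in>F. bump s x y)) * (h y)\<^sup>2)"
  have sum1: "0 \<le> (\<Sum>x\<in>F. bump s x y)" "(\<Sum>x\<in>F. bump s x y) \<le> 1" for y
    by (auto intro!: sum_nonneg bump_nonneg sum_bump_le_1 s fin disj)
  have \<psi>_nonneg: "0 \<le> \<psi> y" for y using sum1 by (simp add: \<psi>_def)
  have \<psi>: "\<psi> \<in> vague_test_functions"
    unfolding vague_test_functions_def
  proof (intro CollectI conjI exI[of _ "{x. h x \<noteq> 0}"] allI impI)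
    show "continuous_on UNIV \<psi>"
      unfolding \<psi>_def bump_def h_def cone_def using s by (intro continuous_intros) auto
    have "\<psi> y \<le> (real n)\<^sup>2" for y
    proof -
      have "\<psi> y \<le> (h y)\<^sup>2" unfolding \<psi>_def using sum1 by (intro mult_left_le_one_le) auto
      also have "\<dots> \<le> (real n)\<^sup>2"
        using cone_le[of n y] cutoff_nonneg[OF h, of y] by (intro power_mono) (auto simp: h_def)
      finally show ?thesis .
    qed
    then show "bounded (range \<psi>)"
      using \<psi>_nonneg by (intro boundedI[of _ "(real n)\<^sup>2"]) auto
    show "bounded {x. h x \<noteq> 0}" using h by (simp add: cutoff_def)
    show "\<psi> y = 0" if "y \<notin> {x. h x \<noteq> 0}" for y using that by (simp add: \<psi>_def)
  qed
  \<comment> \<open>A vaguely continuous upper bound for the cost of moving \<open>\<gamma>\<close> to \<open>\<eta>\<close>, which is small at \<open>\<eta> = \<gamma>\<close>.\<close>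
  define G where "G = (\<lambda>\<eta>. s\<^sup>2 * N + (real n)\<^sup>2 * (\<Sum>x\<in>F. \<bar>integral\<^sup>L \<eta> (bump s x) - mu x\<bar>) + integral\<^sup>L \<eta> \<psi>)"
  have contG: "continuous_map (vague_topology M) euclideanreal G"
    unfolding G_def
    by (intro continuous_map_add continuous_map_real_mult_left continuous_map_sum continuous_map_real_abs
        continuous_map_diff continuous_map_integral bump_test_function s \<psi> fin) auto
  define U where "U = {\<eta> \<in> configurations M. G \<eta> < (r / 2)\<^sup>2}"
  have "openin (vague_topology M) {\<eta> \<in> topspace (vague_topology M). G \<eta> \<in> {..<(r / 2)\<^sup>2}}"
    by (rule openin_continuous_map_preimage[OF contG]) simp
  then have "openin (vague_topology M) U"
    by (simp add: topspace_vague_topology U_def)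
  moreover have "\<gamma> \<in> U"
  proof -
    have "integral\<^sup>L \<gamma> (bump s x) = mu x" if x: "x \<in> F" for x
    proof -
      have "weight \<gamma> y * ennreal (bump s x y) = 0" if "y \<noteq> x" for y
      proof (cases "weight \<gamma> y = 0 \<or> s \<le> dist x y")
        case False
        \<comment> \<open>Since \<open>s \<le> h x\<close>, the ball of radius \<open>s\<close> stays above the reservoir, so that \<open>F\<close> contains all
          atoms in it.\<close>
        then have "0 < h y" using sh[OF x] cutoff_lipschitz[OF h, of x y] by simp
        then have "y \<in> F" using False by (simp add: F_def)
        then have False using disj[OF x _ that[symmetric]] False s by fastforce
        then show ?thesis ..
      qed (use s in \<open>auto simp: bump_eq_0\<close>)
      then have "(\<Sum>\<^sup>+y. weight \<gamma> y * ennreal (bump s x y)) = weight \<gamma> x"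
        by (subst usum_single[where x = x]) auto
      then have "ennreal (integral\<^sup>L \<gamma> (bump s x)) = ennreal (mu x)"
        using integral_test_function[OF g M bump_test_function[OF s] bump_nonneg, of x] mu by simp
      moreover have "0 \<le> integral\<^sup>L \<gamma> (bump s x)" by (simp add: bump_nonneg)
      ultimately show ?thesis using mu by (simp add: ennreal_inj)
    qed
    moreover have "integral\<^sup>L \<gamma> \<psi> = 0"
    proof -
      have "weight \<gamma> y * ennreal (\<psi> y) = 0" for y
      proof (cases "y \<in> F")
        case True
        have "bump s y y \<le> (\<Sum>x\<in>F. bump s x y)"
          by (rule member_le_sum[OF True]) (auto simp: bump_nonneg fin)
        then have "(\<Sum>x\<in>F. bump s x y) = 1" using sum1(2)[of y] by simp
        then show ?thesis by (simp add: \<psi>_def)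
      qed (auto simp: F_def \<psi>_def)
      then have "ennreal (integral\<^sup>L \<gamma> \<psi>) = 0"
        unfolding integral_test_function[OF g M \<psi> \<psi>_nonneg, symmetric] by (simp del: mult_eq_0_iff)
      moreover have "0 \<le> integral\<^sup>L \<gamma> \<psi>" by (simp add: \<psi>_nonneg)
      ultimately show ?thesis by (simp add: ennreal_eq_0_iff)
    qed
    ultimately show ?thesis using sN g by (simp add: U_def G_def)
  qed
  moreover have "U \<subseteq> {\<eta> \<in> configurations M. level_dist n \<gamma> \<eta> < r}"
  proof
    fix \<eta> assume "\<eta> \<in> U"
    then have eta: "\<eta> \<in> configurations M" and G: "G \<eta> < (r / 2)\<^sup>2" by (auto simp: U_def)
    have "\<exists>w. plan (weight \<gamma>) (weight \<eta>) w \<and> cost h w \<le>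
      ennreal (s\<^sup>2 * (\<Sum>x\<in>F. mu x) + (real n)\<^sup>2 * (\<Sum>x\<in>F. \<bar>integral\<^sup>L \<eta> (bump s x) - mu x\<bar>) + integral\<^sup>L \<eta> \<psi>)"
    proof (rule plan_to_nearby[OF h _ lf locally_finite_weight[OF eta M] F_def s disj])
      show "h x \<le> real n" for x by (simp add: h_def cone_le)
      show "(\<Sum>\<^sup>+y. weight \<eta> y * ennreal (bump s x y)) = ennreal (integral\<^sup>L \<eta> (bump s x))" for x
        by (rule integral_test_function[OF eta M bump_test_function[OF s] bump_nonneg])
      show "0 \<le> integral\<^sup>L \<eta> (bump s x)" for x by (simp add: bump_nonneg)
      show "(\<Sum>\<^sup>+y. weight \<eta> y * ennreal ((1 - (\<Sum>x\<in>F. bump s x y)) * (h y)\<^sup>2)) = ennreal (integral\<^sup>L \<eta> \<psi>)"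
        using integral_test_function[OF eta M \<psi> \<psi>_nonneg] by (simp add: \<psi>_def)
      show "0 \<le> integral\<^sup>L \<eta> \<psi>" by (simp add: \<psi>_nonneg)
    qed (auto simp: mu)
    then obtain w where "plan (weight \<gamma>) (weight \<eta>) w" "cost h w \<le> ennreal (G \<eta>)"
      by (auto simp: G_def N_def)
    then have "level_dist n \<gamma> \<eta> \<le> r / 2"
      unfolding level_dist_def h_def using r G
      by (intro partial_transport_leI) (auto elim!: order_trans intro!: ennreal_leI)
    then show "\<eta> \<in> {\<eta> \<in> configurations M. level_dist n \<gamma> \<eta> < r}" using eta r by simp
  qed
  ultimately show "\<exists>U. openin (vague_topology M) U \<and> \<gamma> \<in> U \<and> U \<subseteq> {\<eta> \<in> configurations M. level_dist n \<gamma> \<eta> < r}"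
    by blast
qed

lemma integral_close_of_level_dist:
  fixes M :: "'a::polish_space measure"
  assumes M: "subalgebra M borel" and g: "\<gamma> \<in> configurations M"
    and f: "f \<in> vague_test_functions" "\<And>x. 0 \<le> f x" and supp: "\<And>x. f x \<noteq> 0 \<Longrightarrow> 1 \<le> cone n x"
    and e: "0 < e"
  shows "\<exists>r>0. \<forall>\<eta>\<in>configurations M. level_dist n \<gamma> \<eta> < r \<longrightarrow> \<bar>integral\<^sup>L \<eta> f - integral\<^sup>L \<gamma> f\<bar> \<le> e"
proof -
  have cont: "continuous_on UNIV f" using f by (simp add: vague_test_functions_def)
  have "bounded (range f)" using f by (simp add: vague_test_functions_def)
  then obtain K where K: "\<And>x. norm (f x) \<le> K" by (auto simp: bounded_iff)
  then have "f x \<le> K" for x using abs_ge_self[of "f x"] order_trans by fastforce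
  then obtain r where r: "0 < r" and close: "\<And>m w. plan (weight \<gamma>) m w \<Longrightarrow> cost (cone n) w \<le> ennreal (r\<^sup>2) \<Longrightarrow>
     (\<Sum>\<^sup>+x. m x * ennreal (f x)) \<le> (\<Sum>\<^sup>+x. weight \<gamma> x * ennreal (f x)) + ennreal e \<and>
     (\<Sum>\<^sup>+x. weight \<gamma> x * ennreal (f x)) \<le> (\<Sum>\<^sup>+x. m x * ennreal (f x)) + ennreal e"
    using integral_close_of_plan[OF cutoff_cone locally_finite_weight[OF g M] cont f(2) _ supp e] by blast
  show ?thesis
  proof (intro exI[of _ r] conjI r ballI impI)
    fix \<eta> assume eta: "\<eta> \<in> configurations M" and less: "level_dist n \<gamma> \<eta> < r"
    obtain w where w: "plan (weight \<gamma>) (weight \<eta>) w" "cost (cone n) w \<le> ennreal (r\<^sup>2)"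
      using partial_transport_lessD[OF cutoff_cone locally_finite_weight[OF g M] locally_finite_weight[OF eta M]
          less[unfolded level_dist_def]] by blast
    have "0 \<le> integral\<^sup>L \<gamma> f" "0 \<le> integral\<^sup>L \<eta> f" by (simp_all add: f)
    then show "\<bar>integral\<^sup>L \<eta> f - integral\<^sup>L \<gamma> f\<bar> \<le> e"
      using close[OF w] e unfolding integral_test_function[OF g M f] integral_test_function[OF eta M f]
      by (simp add: ennreal_plus[symmetric] ennreal_le_iff abs_le_iff del: ennreal_plus)
  qed
qed

lemma vague_neighbourhood_level_dist:
  fixes M :: "'a::polish_space measure"
  assumes M: "subalgebra M borel" and f: "f \<in> vague_test_functions" and U: "open U"
    and g: "\<gamma> \<in> configurations M" "integral\<^sup>L \<gamma> f \<in> U"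
  shows "\<exists>n. \<exists>r>0. {\<eta> \<in> configurations M. level_dist n \<gamma> \<eta> < r} \<subseteq> {\<eta> \<in> configurations M. integral\<^sup>L \<eta> f \<in> U}"
proof -
  obtain e where e: "0 < e" "ball (integral\<^sup>L \<gamma> f) e \<subseteq> U"
    using U g(2) open_contains_ball by blast
  obtain B where B: "bounded B" "\<And>x. x \<notin> B \<Longrightarrow> f x = 0" and "bounded (range f)" "continuous_on UNIV f"
    using f by (auto simp: vague_test_functions_def)
  then obtain K where K: "\<And>x. \<bar>f x\<bar> \<le> K" by (auto simp: bounded_iff)
  obtain R where R: "\<And>x. x \<in> B \<Longrightarrow> dist undefined x \<le> R"
    using B(1) bounded_any_center[of B undefined] by blast
  obtain n :: nat where n: "R + 1 \<le> real n" using real_arch_simple by blast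
  define f1 where "f1 = (\<lambda>x. max 0 (f x))"
  define f2 where "f2 = (\<lambda>x. max 0 (- f x))"
  have supp: "1 \<le> cone n x" if "f x \<noteq> 0" for x
  proof -
    have "x \<in> B" using that B(2) by blast
    then show ?thesis using R[of x] n by (simp add: cone_def)
  qed
  have test: "f1 \<in> vague_test_functions" "f2 \<in> vague_test_functions"
  proof -
    have "continuous_on UNIV f1" "continuous_on UNIV f2"
      unfolding f1_def f2_def using \<open>continuous_on UNIV f\<close> by (auto intro!: continuous_intros)
    moreover have "norm (f1 x) \<le> K" "norm (f2 x) \<le> K" for x
      using K[of x] by (auto simp: f1_def f2_def)
    then have "bounded (range f1)" "bounded (range f2)" by (auto intro!: boundedI)
    moreover have "\<exists>B. bounded B \<and> (\<forall>x. x \<notin> B \<longrightarrow> f1 x = 0)" "\<exists>B. bounded B \<and> (\<forall>x. x \<notin> B \<longrightarrow> f2 x = 0)"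
      using B by (auto simp: f1_def f2_def intro!: exI[of _ B])
    ultimately show "f1 \<in> vague_test_functions" "f2 \<in> vague_test_functions"
      by (auto simp: vague_test_functions_def)
  qed
  have split: "integral\<^sup>L \<eta> f = integral\<^sup>L \<eta> f1 - integral\<^sup>L \<eta> f2" if "\<eta> \<in> configurations M" for \<eta>
  proof -
    have "integral\<^sup>L \<eta> f = integral\<^sup>L \<eta> (\<lambda>x. f1 x - f2 x)"
      by (intro Bochner_Integration.integral_cong) (auto simp: f1_def f2_def)
    then show ?thesis
      using integrable_test_function[OF that M] test by simp
  qed
  have e3: "0 < e / 3" using e by simp
  obtain r1 where r1: "0 < r1"
    "\<And>\<eta>. \<eta> \<in> configurations M \<Longrightarrow> level_dist n \<gamma> \<eta> < r1 \<Longrightarrow> \<bar>integral\<^sup>L \<eta> f1 - integral\<^sup>L \<gamma> f1\<bar> \<le> e / 3"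
    using integral_close_of_level_dist[OF M g(1) test(1) _ _ e3, of n] supp by (auto simp: f1_def)
  obtain r2 where r2: "0 < r2"
    "\<And>\<eta>. \<eta> \<in> configurations M \<Longrightarrow> level_dist n \<gamma> \<eta> < r2 \<Longrightarrow> \<bar>integral\<^sup>L \<eta> f2 - integral\<^sup>L \<gamma> f2\<bar> \<le> e / 3"
    using integral_close_of_level_dist[OF M g(1) test(2) _ _ e3, of n] supp by (auto simp: f2_def)
  show ?thesis
  proof (intro exI[of _ n] exI[of _ "min r1 r2"] conjI subsetI)
    show "0 < min r1 r2" using r1 r2 by simp
    fix \<eta> assume "\<eta> \<in> {\<eta> \<in> configurations M. level_dist n \<gamma> \<eta> < min r1 r2}"
    then have eta: "\<eta> \<in> configurations M" "level_dist n \<gamma> \<eta> < r1" "level_dist n \<gamma> \<eta> < r2" by auto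
    have "\<bar>integral\<^sup>L \<gamma> f - integral\<^sup>L \<eta> f\<bar> < e"
      using r1(2)[OF eta(1,2)] r2(2)[OF eta(1,3)] e unfolding split[OF g(1)] split[OF eta(1)] by linarith
    then have "integral\<^sup>L \<eta> f \<in> ball (integral\<^sup>L \<gamma> f) e" by (simp add: dist_real_def)
    then show "\<eta> \<in> {\<eta> \<in> configurations M. integral\<^sup>L \<eta> f \<in> U}" using e eta by auto
  qed
qed

lemma level_dist_separates:
  fixes M :: "'a::polish_space measure"
  assumes M: "subalgebra M borel" and g: "\<gamma> \<in> configurations M" and eta: "\<eta> \<in> configurations M"
    and zero: "\<And>n. level_dist n \<gamma> \<eta> = 0"
  shows "\<gamma> = \<eta>"
proof -
  have int: "integral\<^sup>L \<gamma> f = integral\<^sup>L \<eta> f" if f: "f \<in> vague_test_functions" for f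
  proof (rule ccontr)
    assume "integral\<^sup>L \<gamma> f \<noteq> integral\<^sup>L \<eta> f"
    then show False
      using vague_neighbourhood_level_dist[OF M f open_Compl[OF closed_singleton] g, of "integral\<^sup>L \<eta> f"] eta zero
      by auto
  qed
  have "weight \<gamma> x = weight \<eta> x" for x
  proof -
    have "finite ({y \<in> ball x 1. weight \<gamma> y \<noteq> 0} \<union> {y \<in> ball x 1. weight \<eta> y \<noteq> 0})"
      by (intro finite_UnI locally_finiteD locally_finite_weight[OF _ M] g eta bounded_ball)
    then obtain d where d: "0 < d"
      and dS: "\<forall>y\<in>{y \<in> ball x 1. weight \<gamma> y \<noteq> 0} \<union> {y \<in> ball x 1. weight \<eta> y \<noteq> 0}. y \<noteq> x \<longrightarrow> d \<le> dist x y"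
      using finite_set_avoid by blast
    define s where "s = min d 1"
    have s: "0 < s" using d by (simp add: s_def)
    have *: "weight \<mu> x = ennreal (integral\<^sup>L \<mu> (bump s x))"
      if mu: "\<mu> \<in> configurations M" "\<And>y. weight \<mu> y \<noteq> 0 \<Longrightarrow> weight \<gamma> y \<noteq> 0 \<or> weight \<eta> y \<noteq> 0" for \<mu>
    proof -
      have "weight \<mu> y * ennreal (bump s x y) = 0" if "y \<noteq> x" for y
      proof (cases "weight \<mu> y = 0")
        case False
        then have "weight \<gamma> y \<noteq> 0 \<or> weight \<eta> y \<noteq> 0" by (rule mu(2))
        then have "d \<le> dist x y \<or> 1 \<le> dist x y"
          using dS that unfolding Ball_def Un_iff mem_Collect_eq mem_ball by (meson not_less)
        then have "s \<le> dist x y" by (auto simp: s_def)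
        then show ?thesis using s by (simp add: bump_eq_0)
      qed simp
      then have "(\<Sum>\<^sup>+y. weight \<mu> y * ennreal (bump s x y)) = weight \<mu> x"
        by (subst usum_single[where x = x]) auto
      then show ?thesis
        using integral_test_function[OF mu(1) M bump_test_function[OF s] bump_nonneg, of x] by simp
    qed
    show ?thesis using *[OF g] *[OF eta] int[OF bump_test_function[OF s], of x] by simp
  qed
  then have "weight \<gamma> = weight \<eta>" by (rule ext)
  then show ?thesis
    using configuration_eq_discrete[OF g M] configuration_eq_discrete[OF eta M] by metis
qed

theorem proposition4p30:
  fixes M :: "'a::polish_space measure"
  assumes "metric_local_structure M"
  shows "extended_metric_topological_space (configurations M) (vague_topology M) (transport_dist M)"
proof -
  have M: "subalgebra M borel"
    using assms by (rule metric_local_structure.borel_subalgebra)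
  show ?thesis
  proof (rule extended_metric_topological_spaceI[OF vague_topology_def topspace_vague_topology])
    show "pseudo_distance_on (configurations M) (level_dist n)" for n
      by (rule pseudo_distance_level_dist[OF M])
    show "small_balls (vague_topology M) (configurations M) (level_dist n)" for n
      by (rule small_balls_level_dist[OF M])
    show "\<exists>n. \<exists>r>0. {\<eta> \<in> configurations M. level_dist n \<gamma> \<eta> < r} \<subseteq> V"
      if "V \<in> {{\<gamma> \<in> configurations M. integral\<^sup>L \<gamma> f \<in> U} | f U. f \<in> vague_test_functions \<and> open U}"
        and "\<gamma> \<in> V" for V \<gamma>
      using that vague_neighbourhood_level_dist[OF M] by blast
    show "\<exists>n. level_dist n \<gamma> \<eta> \<noteq> 0"
      if "\<gamma> \<in> configurations M" "\<eta> \<in> configurations M" "\<gamma> \<noteq> \<eta>" for \<gamma> \<eta>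
      using level_dist_separates[OF M that(1,2)] that(3) by blast
    show "transport_dist M \<gamma> \<eta> = (SUP n. ennreal (level_dist n \<gamma> \<eta>))"
      if "\<gamma> \<in> configurations M" "\<eta> \<in> configurations M" for \<gamma> \<eta>
      by (rule transport_dist_eq_SUP[OF M that])
  qed
qed

end
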